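(* Consider the arclength functional $\mathcal L=\int_I\Lambda\,dx$, $I\subseteq[-\frac{\pi}{2},\frac{\pi}{2}]$, of the unit 3-sphere $S^3\subset\mathbb R^4$ (the glome) in hyperspherical coordinates $(x,y,v)$, where $$\Lambda=\sqrt{1+\cos^2x\,y_x^2+\cos^2x\cos^2y\,v_x^2},$$ and the associated system of geodesic (Euler–Lagrange) ordinary differential equations for $y(x),v(x)$. A general infinitesimal symmetry accommodated by this system, obtained by solving the infinitesimal variational symmetry criterion $\mathrm{pr}^{(1)}\mathbf v(\Lambda)+\Lambda\,\frac{d\xi}{dx}=0$ for $\mathbf v=\xi\,\frac{\partial}{\partial x}+\phi\,\frac{\partial}{\partial y}+\eta\,\frac{\partial}{\partial v}$, is $$\mathbf v=\big[(k_1\cos v+k_2\sin v)\cos y+k_3\sin y\big]\frac{\partial}{\partial x}$$ $$+\big[(k_1\cos v+k_2\sin v)\tan x\sin y-k_3\tan x\cos y+k_4\cos v+k_5\sin v\big]\frac{\partial}{\partial y}$$ $$+\big[(k_1\sin v-k_2\cos v)\tan x\sec y+(k_4\sin v-k_5\cos v)\tan y\big]\frac{\partial}{\partial v},$$ where $k_1,\dots,k_5$ are arbitrary constants. It separates into one-parameter symmetries as $\mathbf v=\sum_{i=1}^5k_i\chi_i$. Computing the Lie brackets of $\chi_1,\dots,\chi_5$ reveals a sixth accommodated infinitesimal symmetry, the trivial translation $\chi_6=\frac{\partial}{\partial v}$.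
   Context: The hyperspherical coordinate system is $f:[-\frac{\pi}{2},\frac{\pi}{2}]^2\times[0,2\pi]\to S^3$, $f(x,y,v)=(\cos x\cos y\cos v,\ \cos x\cos y\sin v,\ \cos x\sin y,\ \sin x)$. Curves are described with $x$ as independent variable, and $y_x,v_x$ denote the first derivatives of $y,v$ with respect to $x$, treated as independent jet variables in the criterion. The coefficients $\xi,\phi,\eta$ are functions of $(x,y,v)$, subscripts on them denote partial derivatives, and $\frac{d\xi}{dx}=\xi_x+\xi_yy_x+\xi_vv_x$. The first prolongation is $\mathrm{pr}^{(1)}\mathbf v=\mathbf v+\phi^x\frac{\partial}{\partial y_x}+\eta^x\frac{\partial}{\partial v_x}$ with $$\phi^x=\phi_x+\phi_yy_x+\phi_vv_x-(\xi_xy_x+\xi_yy_x^2+\xi_vv_xy_x),$$ $$\eta^x=\eta_x+\eta_yy_x+\eta_vv_x-(\xi_xv_x+\xi_yy_xv_x+\xi_vv_x^2).$$ *)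

theory Defs
  imports "HOL-Analysis.Analysis"
begin

definition hyperspherical :: "real \<Rightarrow> real \<Rightarrow> real \<Rightarrow> real ^ 4" where
  "hyperspherical x y v =
     vector [cos x * cos y * cos v, cos x * cos y * sin v, cos x * sin y, sin x]"

text \<open>The arclength of the curve \<open>x \<mapsto> hyperspherical x (y x) (v x)\<close>, \<open>x \<in> I\<close>,
  in the unit 3-sphere of \<open>\<real>\<^sup>4\<close>. Derivatives are taken within \<open>I\<close> (one-sided at end points).\<close>

definition arclength :: "real set \<Rightarrow> (real \<Rightarrow> real) \<Rightarrow> (real \<Rightarrow> real) \<Rightarrow> real" where
  "arclength I y v =
     integral I (\<lambda>x. norm (vector_derivative (\<lambda>t. hyperspherical t (y t) (v t)) (at x within I)))"

text \<open>Jet coordinates: \<open>p\<close>, \<open>q\<close> stand for \<open>y\<^sub>x\<close>, \<open>v\<^sub>x\<close> and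
  \<open>r\<close>, \<open>s\<close> for \<open>y\<^sub>x\<^sub>x\<close>, \<open>v\<^sub>x\<^sub>x\<close>; functions on the first and second jet spaces are curried.\<close>

type_synonym jet1_fun = "real \<Rightarrow> real \<Rightarrow> real \<Rightarrow> real \<Rightarrow> real \<Rightarrow> real"
type_synonym jet2_fun =
  "real \<Rightarrow> real \<Rightarrow> real \<Rightarrow> real \<Rightarrow> real \<Rightarrow> real \<Rightarrow> real \<Rightarrow> real"

definition Lam :: jet1_fun where
  "Lam x y v p q = sqrt (1 + (cos x)\<^sup>2 * p\<^sup>2 + (cos x)\<^sup>2 * (cos y)\<^sup>2 * q\<^sup>2)"

text \<open>The domain of the hyperspherical coordinates is restricted to its interior: \<open>tan\<close> and \<open>sec\<close>
  are singular where \<open>x\<close> or \<open>y\<close> is \<open>\<plusminus>\<pi>/2\<close>.\<close>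

definition chart :: "(real \<times> real \<times> real) set" where
  "chart = {- pi / 2 <..< pi / 2} \<times> {- pi / 2 <..< pi / 2} \<times> {0 <..< 2 * pi}"

text \<open>A vector field \<open>\<xi> \<partial>/\<partial>x + \<phi> \<partial>/\<partial>y + \<eta> \<partial>/\<partial>v\<close> is represented by its coefficient triple
  \<open>(\<xi>, \<phi>, \<eta>)\<close> as a function of \<open>(x, y, v)\<close>; only its values on \<open>chart\<close> matter.\<close>

type_synonym vfield = "real \<times> real \<times> real \<Rightarrow> real \<times> real \<times> real"

definition xi :: "vfield \<Rightarrow> real \<Rightarrow> real \<Rightarrow> real \<Rightarrow> real" where
  "xi V x y v = fst (V (x, y, v))"

definition phi :: "vfield \<Rightarrow> real \<Rightarrow> real \<Rightarrow> real \<Rightarrow> real" where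
  "phi V x y v = fst (snd (V (x, y, v)))"

definition eta :: "vfield \<Rightarrow> real \<Rightarrow> real \<Rightarrow> real \<Rightarrow> real" where
  "eta V x y v = snd (snd (V (x, y, v)))"

definition d_x :: "(real \<Rightarrow> real \<Rightarrow> real \<Rightarrow> real) \<Rightarrow> real \<Rightarrow> real \<Rightarrow> real \<Rightarrow> real" where
  "d_x F x y v = deriv (\<lambda>t. F t y v) x"

definition d_y :: "(real \<Rightarrow> real \<Rightarrow> real \<Rightarrow> real) \<Rightarrow> real \<Rightarrow> real \<Rightarrow> real \<Rightarrow> real" where
  "d_y F x y v = deriv (\<lambda>t. F x t v) y"

definition d_v :: "(real \<Rightarrow> real \<Rightarrow> real \<Rightarrow> real) \<Rightarrow> real \<Rightarrow> real \<Rightarrow> real \<Rightarrow> real" where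
  "d_v F x y v = deriv (\<lambda>t. F x y t) v"

definition total_xi :: "vfield \<Rightarrow> jet1_fun" where
  "total_xi V x y v p q = d_x (xi V) x y v + d_y (xi V) x y v * p + d_v (xi V) x y v * q"

definition phi1 :: "vfield \<Rightarrow> jet1_fun" where
  "phi1 V x y v p q =
     d_x (phi V) x y v + d_y (phi V) x y v * p + d_v (phi V) x y v * q
     - (d_x (xi V) x y v * p + d_y (xi V) x y v * p\<^sup>2 + d_v (xi V) x y v * q * p)"

definition eta1 :: "vfield \<Rightarrow> jet1_fun" where
  "eta1 V x y v p q =
     d_x (eta V) x y v + d_y (eta V) x y v * p + d_v (eta V) x y v * q
     - (d_x (xi V) x y v * q + d_y (xi V) x y v * p * q + d_v (xi V) x y v * q\<^sup>2)"

definition pr1 :: "vfield \<Rightarrow> jet1_fun \<Rightarrow> jet1_fun" where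
  "pr1 V F x y v p q =
     xi V x y v * deriv (\<lambda>t. F t y v p q) x
     + phi V x y v * deriv (\<lambda>t. F x t v p q) y
     + eta V x y v * deriv (\<lambda>t. F x y t p q) v
     + phi1 V x y v p q * deriv (\<lambda>t. F x y v t q) p
     + eta1 V x y v p q * deriv (\<lambda>t. F x y v p t) q"

text \<open>Differentiability is all the criterion needs to make sense, so no further smoothness of the
  coefficients is required.\<close>

definition variational_symmetry :: "vfield \<Rightarrow> bool" where
  "variational_symmetry V \<longleftrightarrow>
     V differentiable_on chart \<and>
     (\<forall>x y v p q. (x, y, v) \<in> chart \<longrightarrow>
        pr1 V Lam x y v p q + Lam x y v p q * total_xi V x y v p q = 0)"

definition total_d :: "jet1_fun \<Rightarrow> jet2_fun" where
  "total_d F x y v p q r s =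
     deriv (\<lambda>t. F t y v p q) x
     + p * deriv (\<lambda>t. F x t v p q) y
     + q * deriv (\<lambda>t. F x y t p q) v
     + r * deriv (\<lambda>t. F x y v t q) p
     + s * deriv (\<lambda>t. F x y v p t) q"

text \<open>The geodesic (Euler--Lagrange) system of \<open>Lam\<close> is \<open>EL_y = 0\<close>, \<open>EL_v = 0\<close>.\<close>

definition EL_y :: jet2_fun where
  "EL_y x y v p q r s =
     deriv (\<lambda>t. Lam x t v p q) y
     - total_d (\<lambda>x y v p q. deriv (\<lambda>t. Lam x y v t q) p) x y v p q r s"

definition EL_v :: jet2_fun where
  "EL_v x y v p q r s =
     deriv (\<lambda>t. Lam x y t p q) v
     - total_d (\<lambda>x y v p q. deriv (\<lambda>t. Lam x y v p t) q) x y v p q r s"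

definition phi2 :: "vfield \<Rightarrow> jet2_fun" where
  "phi2 V x y v p q r s =
     total_d (phi1 V) x y v p q r s - r * total_xi V x y v p q"

definition eta2 :: "vfield \<Rightarrow> jet2_fun" where
  "eta2 V x y v p q r s =
     total_d (eta1 V) x y v p q r s - s * total_xi V x y v p q"

definition pr2 :: "vfield \<Rightarrow> jet2_fun \<Rightarrow> jet2_fun" where
  "pr2 V F x y v p q r s =
     xi V x y v * deriv (\<lambda>t. F t y v p q r s) x
     + phi V x y v * deriv (\<lambda>t. F x t v p q r s) y
     + eta V x y v * deriv (\<lambda>t. F x y t p q r s) v
     + phi1 V x y v p q * deriv (\<lambda>t. F x y v t q r s) p
     + eta1 V x y v p q * deriv (\<lambda>t. F x y v p t r s) q
     + phi2 V x y v p q r s * deriv (\<lambda>t. F x y v p q t s) r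
     + eta2 V x y v p q r s * deriv (\<lambda>t. F x y v p q r t) s"

text \<open>Lie's infinitesimal criterion for a point symmetry of the geodesic system: the second
  prolongation annihilates the equations on their solution set in the second jet space.\<close>

definition geodesic_system_symmetry :: "vfield \<Rightarrow> bool" where
  "geodesic_system_symmetry V \<longleftrightarrow>
     (\<forall>x y v p q r s. (x, y, v) \<in> chart \<longrightarrow>
        EL_y x y v p q r s = 0 \<longrightarrow> EL_v x y v p q r s = 0 \<longrightarrow>
        pr2 V EL_y x y v p q r s = 0 \<and> pr2 V EL_v x y v p q r s = 0)"

definition apply_vf :: "vfield \<Rightarrow> (real \<Rightarrow> real \<Rightarrow> real \<Rightarrow> real) \<Rightarrow> real \<Rightarrow> real \<Rightarrow> real \<Rightarrow> real" where
  "apply_vf V F x y v =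
     xi V x y v * d_x F x y v + phi V x y v * d_y F x y v + eta V x y v * d_v F x y v"

definition lie_bracket :: "vfield \<Rightarrow> vfield \<Rightarrow> vfield" where
  "lie_bracket V W = (\<lambda>(x, y, v).
     (apply_vf V (xi W) x y v - apply_vf W (xi V) x y v,
      apply_vf V (phi W) x y v - apply_vf W (phi V) x y v,
      apply_vf V (eta W) x y v - apply_vf W (eta V) x y v))"

definition sec :: "real \<Rightarrow> real" where
  "sec t = 1 / cos t"

definition glome_field :: "real \<Rightarrow> real \<Rightarrow> real \<Rightarrow> real \<Rightarrow> real \<Rightarrow> vfield" where
  "glome_field k1 k2 k3 k4 k5 = (\<lambda>(x, y, v).
     ((k1 * cos v + k2 * sin v) * cos y + k3 * sin y,
      (k1 * cos v + k2 * sin v) * tan x * sin y - k3 * tan x * cos y + k4 * cos v + k5 * sin v,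
      (k1 * sin v - k2 * cos v) * tan x * sec y + (k4 * sin v - k5 * cos v) * tan y))"

definition chi1 :: vfield where
  "chi1 = (\<lambda>(x, y, v). (cos v * cos y, cos v * tan x * sin y, sin v * tan x * sec y))"

definition chi2 :: vfield where
  "chi2 = (\<lambda>(x, y, v). (sin v * cos y, sin v * tan x * sin y, - cos v * tan x * sec y))"

definition chi3 :: vfield where
  "chi3 = (\<lambda>(x, y, v). (sin y, - tan x * cos y, 0))"

definition chi4 :: vfield where
  "chi4 = (\<lambda>(x, y, v). (0, cos v, sin v * tan y))"

definition chi5 :: vfield where
  "chi5 = (\<lambda>(x, y, v). (0, sin v, - cos v * tan y))"

definition chi6 :: vfield where
  "chi6 = (\<lambda>(x, y, v). (0, 0, 1))"

end

theory Submission
  imports Defs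
begin

text \<open>Multiplied by \<open>Lam\<close>, the variational criterion is a polynomial of degree two in the jet
  variables (the cubic terms cancel), and its six coefficients are Killing's equations for
  \<open>dx\<^sup>2 + cos\<^sup>2 x dy\<^sup>2 + cos\<^sup>2 x cos\<^sup>2 y dv\<^sup>2\<close>. They force \<open>\<xi>\<close> to be independent of \<open>x\<close>,
  and \<open>\<phi>\<close> and \<open>\<eta>\<close> to be affine in \<open>tan x\<close> with slopes given by the first derivatives of
  \<open>\<xi>\<close>. Comparing the slices \<open>x = 0\<close> and \<open>x = \<pi>/4\<close>, where \<open>tan x\<close> is 0 and 1, therefore
  expresses these first derivatives through \<open>\<phi>\<close> and \<open>\<eta>\<close>, so that they are differentiable
  again although \<open>\<xi>\<close> was only assumed to be differentiable once; the remaining equations become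
  harmonic oscillators in \<open>y\<close> and in \<open>v\<close>.

  The Euler--Lagrange expressions are combinations of \<open>r - geo_y\<close> and \<open>s - geo_v\<close> with an
  invertible matrix of coefficients. Since \<open>pr2\<close> is a derivation, the geodesic system is
  invariant as soon as \<open>phi2\<close> and \<open>eta2\<close> are the derivatives of \<open>geo_y\<close> and \<open>geo_v\<close> along
  the prolonged field, which is a polynomial identity modulo the Pythagorean relations.\<close>

section \<open>First derivatives of the arclength integrand\<close>

lemma Lam_pos: "Lam x y v p q > 0"
  unfolding Lam_def by (simp add: add_pos_nonneg)

lemma Lam_sq: "(Lam x y v p q)\<^sup>2 = 1 + (cos x)\<^sup>2 * p\<^sup>2 + (cos x)\<^sup>2 * (cos y)\<^sup>2 * q\<^sup>2"
  unfolding Lam_def by (simp add: add_nonneg_nonneg)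

lemma radicand_pos: "1 + (cos x)\<^sup>2 * p\<^sup>2 + (cos x)\<^sup>2 * (cos y)\<^sup>2 * q\<^sup>2 > (0::real)"
  by (simp add: add_pos_nonneg)

text \<open>Stating the derivative of the radicand as \<open>2 * w\<close> absorbs the factor 1/2 of
  the square root, so the derivatives of \<open>Lam\<close> come out as root-free numerators over
  \<open>Lam\<close>.\<close>

lemma DERIV_sqrt_half:
  fixes g :: "real \<Rightarrow> real"
  assumes "(g has_real_derivative 2 * w) (at z)" "g z > 0"
  shows "((\<lambda>t. sqrt (g t)) has_real_derivative w / sqrt (g z)) (at z)"
  using DERIV_chain2[OF DERIV_real_sqrt[OF assms(2)] assms(1)] by (simp add: field_simps)

lemma DERIV_Lam:
  "((\<lambda>t. Lam t y v p q) has_real_derivative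
     - (cos x * sin x * (p\<^sup>2 + (cos y)\<^sup>2 * q\<^sup>2)) / Lam x y v p q) (at x)"
  "((\<lambda>t. Lam x t v p q) has_real_derivative
     - ((cos x)\<^sup>2 * cos y * sin y * q\<^sup>2) / Lam x y v p q) (at y)"
  "((\<lambda>t. Lam x y t p q) has_real_derivative 0) (at v)"
  "((\<lambda>t. Lam x y v t q) has_real_derivative (cos x)\<^sup>2 * p / Lam x y v p q) (at p)"
  "((\<lambda>t. Lam x y v p t) has_real_derivative (cos x)\<^sup>2 * (cos y)\<^sup>2 * q / Lam x y v p q) (at q)"
  unfolding Lam_def
  subgoal by (rule DERIV_sqrt_half, (auto intro!: derivative_eq_intros simp: algebra_simps)[1], rule radicand_pos)
  subgoal by (rule DERIV_sqrt_half, (auto intro!: derivative_eq_intros simp: algebra_simps)[1], rule radicand_pos)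
  subgoal by auto
  subgoal by (rule DERIV_sqrt_half, (auto intro!: derivative_eq_intros simp: algebra_simps)[1], rule radicand_pos)
  subgoal by (rule DERIV_sqrt_half, (auto intro!: derivative_eq_intros simp: algebra_simps)[1], rule radicand_pos)
  done

lemma deriv_Lam:
  "deriv (\<lambda>t. Lam t y v p q) x =
     - (cos x * sin x * (p\<^sup>2 + (cos y)\<^sup>2 * q\<^sup>2)) / Lam x y v p q"
  "deriv (\<lambda>t. Lam x t v p q) y = - ((cos x)\<^sup>2 * cos y * sin y * q\<^sup>2) / Lam x y v p q"
  "deriv (\<lambda>t. Lam x y t p q) v = 0"
  "deriv (\<lambda>t. Lam x y v t q) p = (cos x)\<^sup>2 * p / Lam x y v p q"
  "deriv (\<lambda>t. Lam x y v p t) q = (cos x)\<^sup>2 * (cos y)\<^sup>2 * q / Lam x y v p q"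
  by (rule DERIV_Lam[THEN DERIV_imp_deriv])+

text \<open>The geodesic system solved for the second derivatives: \<open>r = geo_y\<close>, \<open>s = geo_v\<close>.\<close>

definition geo_y :: "real \<Rightarrow> real \<Rightarrow> real \<Rightarrow> real \<Rightarrow> real" where
  "geo_y x y p q =
     2 * tan x * p - cos y * sin y * q\<^sup>2 + p * (cos x * sin x * (p\<^sup>2 + (cos y)\<^sup>2 * q\<^sup>2))"

definition geo_v :: "real \<Rightarrow> real \<Rightarrow> real \<Rightarrow> real \<Rightarrow> real" where
  "geo_v x y p q =
     2 * tan x * q + 2 * tan y * p * q + q * (cos x * sin x * (p\<^sup>2 + (cos y)\<^sup>2 * q\<^sup>2))"

section \<open>The Euler-Lagrange expressions in terms of the solved system\<close>

text \<open>Meant for \<open>f = Lam\<close>, whose derivative has the form \<open>l / f\<close>: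
  over the denominator \<open>f ^ 3\<close> the quotient rule leaves a numerator in which
  \<open>f\<close> occurs only squared, so the root disappears.\<close>

lemma DERIV_quotient_cube:
  fixes f g :: "real \<Rightarrow> real"
  assumes "(g has_real_derivative g') (at z)" "(f has_real_derivative l / f z) (at z)" "f z \<noteq> 0"
  shows "((\<lambda>t. g t / f t) has_real_derivative (g' * (f z)\<^sup>2 - g z * l) / f z ^ 3) (at z)"
  using DERIV_divide[OF assms] assms(3)
  by (simp add: field_simps power2_eq_square power3_eq_cube)

lemma cos_sq_DERIV:
  "((\<lambda>t. (cos t)\<^sup>2 * c) has_real_derivative - 2 * cos t * sin t * c) (at t)"
  "((\<lambda>t. (cos t)\<^sup>2 * c * d) has_real_derivative - 2 * cos t * sin t * c * d) (at t)"
  "((\<lambda>t. c * (cos t)\<^sup>2 * d) has_real_derivative - 2 * c * cos t * sin t * d) (at t)"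
  by (auto intro!: derivative_eq_intros)

lemma Lam_nonzero: "Lam x y v p q \<noteq> 0"
  using Lam_pos[of x y v p q] by simp

text \<open>Writing zero as \<open>0 / Lam x y v p q\<close> makes it fit the second premise of
  \<open>DERIV_quotient_cube\<close>.\<close>

lemma DERIV_Lam_v: "((\<lambda>t. Lam x y t p q) has_real_derivative 0 / Lam x y v p q) (at v)"
  using DERIV_Lam(3)[of x y p q v] by simp

text \<open>Partial derivatives of the momentum \<open>(cos x)\<^sup>2 * p / Lam x y v p q\<close>,
  in the order x, y, v, p, q in which \<open>total_d\<close> uses them.\<close>

lemmas deriv_Lam_p =
  DERIV_quotient_cube[OF cos_sq_DERIV(1)[where c = p] DERIV_Lam(1) Lam_nonzero,
    THEN DERIV_imp_deriv]
  DERIV_quotient_cube[OF DERIV_const[where k = "(cos x)\<^sup>2 * p"] DERIV_Lam(2) Lam_nonzero,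
    THEN DERIV_imp_deriv]
  DERIV_quotient_cube[OF DERIV_const[where k = "(cos x)\<^sup>2 * p"] DERIV_Lam_v Lam_nonzero,
    THEN DERIV_imp_deriv]
  DERIV_quotient_cube[OF DERIV_cmult[OF DERIV_ident, where c = "(cos x)\<^sup>2"] DERIV_Lam(4) Lam_nonzero,
    THEN DERIV_imp_deriv]
  DERIV_quotient_cube[OF DERIV_const[where k = "(cos x)\<^sup>2 * p"] DERIV_Lam(5) Lam_nonzero,
    THEN DERIV_imp_deriv]
  for x p

lemmas deriv_Lam_q =
  DERIV_quotient_cube[OF cos_sq_DERIV(2)[where c = "(cos y)\<^sup>2" and d = q] DERIV_Lam(1) Lam_nonzero,
    THEN DERIV_imp_deriv]
  DERIV_quotient_cube[OF cos_sq_DERIV(3)[where c = "(cos x)\<^sup>2" and d = q] DERIV_Lam(2) Lam_nonzero,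
    THEN DERIV_imp_deriv]
  DERIV_quotient_cube[OF DERIV_const[where k = "(cos x)\<^sup>2 * (cos y)\<^sup>2 * q"] DERIV_Lam_v Lam_nonzero,
    THEN DERIV_imp_deriv]
  DERIV_quotient_cube[OF DERIV_const[where k = "(cos x)\<^sup>2 * (cos y)\<^sup>2 * q"] DERIV_Lam(4) Lam_nonzero,
    THEN DERIV_imp_deriv]
  DERIV_quotient_cube[OF DERIV_cmult[OF DERIV_ident, where c = "(cos x)\<^sup>2 * (cos y)\<^sup>2"] DERIV_Lam(5) Lam_nonzero,
    THEN DERIV_imp_deriv]
  for x y q

text \<open>Second derivatives enter \<open>EL_y\<close> only through the total derivative of the
  momentum, so the coefficients of \<open>r\<close> and \<open>s\<close> are minus the entries of
  the Hessian of \<open>Lam\<close> in \<open>p\<close> and \<open>q\<close>; \<open>geo_y\<close>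
  and \<open>geo_v\<close> account for the terms free of \<open>r\<close> and
  \<open>s\<close>.\<close>

lemma EL_y_factor:
  assumes "cos x \<noteq> 0" "cos y \<noteq> 0"
  shows "EL_y x y v p q r s =
    - ((cos x)\<^sup>2 * (1 + (cos x)\<^sup>2 * (cos y)\<^sup>2 * q\<^sup>2)) / Lam x y v p q ^ 3 * (r - geo_y x y p q)
    + (cos x)\<^sup>2 * (cos x)\<^sup>2 * (cos y)\<^sup>2 * p * q / Lam x y v p q ^ 3 * (s - geo_v x y p q)"
proof -
  define L where "L = Lam x y v p q"
  have L0: "L \<noteq> 0" using Lam_pos[of x y v p q] by (simp add: L_def)
  have L2: "L\<^sup>2 = 1 + (cos x)\<^sup>2 * p\<^sup>2 + (cos x)\<^sup>2 * (cos y)\<^sup>2 * q\<^sup>2" by (simp add: L_def Lam_sq)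
  \<comment> \<open>Over the common denominator \<open>L ^ 3\<close> only even powers of
    \<open>L\<close> remain, and \<open>L2\<close> makes them polynomial; with sines written through
    tangents the numerators are left to \<open>algebra\<close>.\<close>
  have inv: "z / L = z * L\<^sup>2 / L ^ 3" for z
    using L0 by (simp add: field_simps power2_eq_square power3_eq_cube)
  have T: "sin x = tan x * cos x" and U: "sin y = tan y * cos y"
    using assms by (auto simp: tan_def)
  show ?thesis
    unfolding EL_y_def total_d_def deriv_Lam geo_y_def geo_v_def
    unfolding deriv_Lam_p
    unfolding L_def[symmetric]
    unfolding inv unfolding times_divide_eq_left times_divide_eq_right add_divide_distrib[symmetric]
      diff_divide_distrib[symmetric]
    by (rule arg_cong[where f = "\<lambda>z. z / L ^ 3"], unfold L2 T U, algebra)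
qed

lemma EL_v_factor:
  assumes "cos x \<noteq> 0" "cos y \<noteq> 0"
  shows "EL_v x y v p q r s =
    (cos x)\<^sup>2 * (cos x)\<^sup>2 * (cos y)\<^sup>2 * p * q / Lam x y v p q ^ 3 * (r - geo_y x y p q)
    + - ((cos x)\<^sup>2 * (cos y)\<^sup>2 * (1 + (cos x)\<^sup>2 * p\<^sup>2)) / Lam x y v p q ^ 3 * (s - geo_v x y p q)"
proof -
  define L where "L = Lam x y v p q"
  have L0: "L \<noteq> 0" using Lam_pos[of x y v p q] by (simp add: L_def)
  have L2: "L\<^sup>2 = 1 + (cos x)\<^sup>2 * p\<^sup>2 + (cos x)\<^sup>2 * (cos y)\<^sup>2 * q\<^sup>2" by (simp add: L_def Lam_sq)
  have inv: "z / L = z * L\<^sup>2 / L ^ 3" for z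
    using L0 by (simp add: field_simps power2_eq_square power3_eq_cube)
  have T: "sin x = tan x * cos x" and U: "sin y = tan y * cos y"
    using assms by (auto simp: tan_def)
  show ?thesis
    unfolding EL_v_def total_d_def deriv_Lam geo_y_def geo_v_def
    unfolding deriv_Lam_q
    unfolding L_def[symmetric]
    unfolding inv unfolding times_divide_eq_left times_divide_eq_right add_divide_distrib[symmetric]
      diff_divide_distrib[symmetric] diff_0 minus_divide_left
    by (rule arg_cong[where f = "\<lambda>z. z / L ^ 3"], unfold L2 T U, algebra)
qed

section \<open>Killing fields and their first prolongation\<close>

text \<open>Six parameters, the dimension of the rotation group of 4-space, treat every
  \<open>glome_field\<close> (\<open>k6 = 0\<close>) and \<open>chi6\<close> in one
  computation.\<close>

definition killing_field :: "real \<Rightarrow> real \<Rightarrow> real \<Rightarrow> real \<Rightarrow> real \<Rightarrow> real \<Rightarrow> vfield" where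
  "killing_field k1 k2 k3 k4 k5 k6 = (\<lambda>P. glome_field k1 k2 k3 k4 k5 P + k6 *\<^sub>R chi6 P)"

text \<open>The combination \<open>k1 sin v - k2 cos v\<close> is \<open>rot (- k2) k1 v\<close>.\<close>

definition rot :: "real \<Rightarrow> real \<Rightarrow> real \<Rightarrow> real" where
  "rot a b v = a * cos v + b * sin v"

lemma DERIV_rot: "(rot a b has_real_derivative rot b (- a) v) (at v)"
  unfolding rot_def[abs_def] by (auto intro!: derivative_eq_intros)

lemma DERIV_tan_sq: "cos x \<noteq> 0 \<Longrightarrow> (tan has_real_derivative 1 + (tan x)\<^sup>2) (at x)"
  using DERIV_tan[of x] tan_sec[of x] by (simp add: inverse_eq_divide power_divide)

lemma DERIV_sec: "cos x \<noteq> 0 \<Longrightarrow> (sec has_real_derivative sec x * tan x) (at x)"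
  unfolding sec_def[abs_def]
  by (auto intro!: derivative_eq_intros simp: tan_def power2_eq_square)

lemmas trig_DERIV = DERIV_rot DERIV_tan_sq DERIV_sec

text \<open>The closed forms below hold only where the cosines do not vanish. This set is open, so
  they may still be substituted inside a derivative in \<open>x\<close> or \<open>y\<close>.\<close>

lemma eventually_cos_nonzero: "cos a \<noteq> 0 \<Longrightarrow> \<forall>\<^sub>F t in nhds a. cos t \<noteq> (0::real)"
  using open_Collect_neq[OF continuous_on_cos[OF continuous_on_id] continuous_on_const[of _ "0::real"]]
  unfolding eventually_nhds by (intro exI[of _ "{t. cos t \<noteq> 0}"]) auto

locale killing =
  fixes k1 k2 k3 k4 k5 k6 :: real
begin

abbreviation "K \<equiv> killing_field k1 k2 k3 k4 k5 k6"

lemma killing_field_components: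
  "xi K = (\<lambda>x y v. rot k1 k2 v * cos y + k3 * sin y)"
  "phi K = (\<lambda>x y v. rot k1 k2 v * tan x * sin y - k3 * tan x * cos y + rot k4 k5 v)"
  "eta K = (\<lambda>x y v. rot (- k2) k1 v * tan x * sec y + rot (- k5) k4 v * tan y + k6)"
  by (auto simp: fun_eq_iff xi_def phi_def eta_def killing_field_def glome_field_def chi6_def rot_def algebra_simps)

context
  fixes x y :: real
  assumes cx: "cos x \<noteq> 0" and cy: "cos y \<noteq> 0"
begin

lemma killing_field_partials:
  "((\<lambda>t. xi K t y v) has_real_derivative 0) (at x)"
  "((\<lambda>t. xi K x t v) has_real_derivative - rot k1 k2 v * sin y + k3 * cos y) (at y)"
  "((\<lambda>t. xi K x y t) has_real_derivative - rot (- k2) k1 v * cos y) (at v)"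
  "((\<lambda>t. phi K t y v) has_real_derivative (1 + (tan x)\<^sup>2) * (rot k1 k2 v * sin y - k3 * cos y)) (at x)"
  "((\<lambda>t. phi K x t v) has_real_derivative tan x * (rot k1 k2 v * cos y + k3 * sin y)) (at y)"
  "((\<lambda>t. phi K x y t) has_real_derivative - rot (- k2) k1 v * tan x * sin y - rot (- k5) k4 v) (at v)"
  "((\<lambda>t. eta K t y v) has_real_derivative (1 + (tan x)\<^sup>2) * rot (- k2) k1 v * sec y) (at x)"
  "((\<lambda>t. eta K x t v) has_real_derivative rot (- k2) k1 v * tan x * sec y * tan y
      + rot (- k5) k4 v * (1 + (tan y)\<^sup>2)) (at y)"
  "((\<lambda>t. eta K x y t) has_real_derivative rot k1 k2 v * tan x * sec y + rot k4 k5 v * tan y) (at v)"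
  unfolding killing_field_components
  by (rule DERIV_cong, (rule trig_DERIV derivative_intros cx cy)+,
      simp add: algebra_simps rot_def)+

lemmas killing_field_d = killing_field_partials[THEN DERIV_imp_deriv]

lemma total_xi_K:
  "total_xi K x y v p q = (- rot k1 k2 v * sin y + k3 * cos y) * p - rot (- k2) k1 v * cos y * q"
  unfolding total_xi_def d_x_def d_y_def d_v_def killing_field_d by simp

lemma phi1_K:
  "phi1 K x y v p q = (1 + (tan x)\<^sup>2) * (rot k1 k2 v * sin y - k3 * cos y)
     + tan x * (rot k1 k2 v * cos y + k3 * sin y) * p
     - (rot (- k2) k1 v * tan x * sin y + rot (- k5) k4 v) * q
     - ((- rot k1 k2 v * sin y + k3 * cos y) * p\<^sup>2 - rot (- k2) k1 v * cos y * q * p)"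
  unfolding phi1_def d_x_def d_y_def d_v_def killing_field_d by (simp add: algebra_simps)

lemma eta1_K:
  "eta1 K x y v p q = (1 + (tan x)\<^sup>2) * rot (- k2) k1 v * sec y
     + (rot (- k2) k1 v * tan x * sec y * tan y + rot (- k5) k4 v * (1 + (tan y)\<^sup>2)) * p
     + (rot k1 k2 v * tan x * sec y + rot k4 k5 v * tan y) * q
     - ((- rot k1 k2 v * sin y + k3 * cos y) * p * q - rot (- k2) k1 v * cos y * q\<^sup>2)"
  unfolding eta1_def d_x_def d_y_def d_v_def killing_field_d by (simp add: algebra_simps)

end

end

section \<open>The second prolongation on the solution set\<close>

lemma DERIV_geo_y:
  assumes "cos x \<noteq> 0" "cos y \<noteq> 0"
  shows
  "((\<lambda>t. geo_y t y p q) has_real_derivative 2 * (1 + (tan x)\<^sup>2) * p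
     + p * ((cos x)\<^sup>2 - (sin x)\<^sup>2) * (p\<^sup>2 + (cos y)\<^sup>2 * q\<^sup>2)) (at x)"
  "((\<lambda>t. geo_y x t p q) has_real_derivative
     - ((cos y)\<^sup>2 - (sin y)\<^sup>2) * q\<^sup>2 - 2 * p * cos x * sin x * cos y * sin y * q\<^sup>2) (at y)"
  "((\<lambda>t. geo_y x y t q) has_real_derivative
     2 * tan x + cos x * sin x * (3 * p\<^sup>2 + (cos y)\<^sup>2 * q\<^sup>2)) (at p)"
  "((\<lambda>t. geo_y x y p t) has_real_derivative
     - 2 * cos y * sin y * q + 2 * p * cos x * sin x * (cos y)\<^sup>2 * q) (at q)"
  unfolding geo_y_def
  by (rule DERIV_cong, (rule trig_DERIV derivative_intros assms)+,
      simp add: algebra_simps power2_eq_square)+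

lemma DERIV_geo_v:
  assumes "cos x \<noteq> 0" "cos y \<noteq> 0"
  shows
  "((\<lambda>t. geo_v t y p q) has_real_derivative 2 * (1 + (tan x)\<^sup>2) * q
     + q * ((cos x)\<^sup>2 - (sin x)\<^sup>2) * (p\<^sup>2 + (cos y)\<^sup>2 * q\<^sup>2)) (at x)"
  "((\<lambda>t. geo_v x t p q) has_real_derivative
     2 * (1 + (tan y)\<^sup>2) * p * q - 2 * cos x * sin x * cos y * sin y * q * q\<^sup>2) (at y)"
  "((\<lambda>t. geo_v x y t q) has_real_derivative
     2 * tan y * q + 2 * p * q * cos x * sin x) (at p)"
  "((\<lambda>t. geo_v x y p t) has_real_derivative
     2 * tan x + 2 * tan y * p + cos x * sin x * (p\<^sup>2 + 3 * (cos y)\<^sup>2 * q\<^sup>2)) (at q)"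
  unfolding geo_v_def
  by (rule DERIV_cong, (rule trig_DERIV derivative_intros assms)+,
      simp add: algebra_simps power2_eq_square)+

context killing
begin

context
  fixes x y :: real
  assumes cx: "cos x \<noteq> 0" and cy: "cos y \<noteq> 0"
begin

text \<open>The five blocks are those of \<open>total_d\<close>: the partial derivatives of
  \<open>phi1 K\<close> in x, y, v, p, q, kept polynomial in \<open>rot\<close>, sines, cosines and
  tangents.\<close>

lemma total_d_phi1_K:
  "total_d (phi1 K) x y v p q r s =
     2 * tan x * (1 + (tan x)\<^sup>2) * (rot k1 k2 v * sin y - k3 * cos y)
      + (1 + (tan x)\<^sup>2) * (rot k1 k2 v * cos y + k3 * sin y) * p
      - rot (- k2) k1 v * (1 + (tan x)\<^sup>2) * sin y * q
   + p * ((1 + (tan x)\<^sup>2) * (rot k1 k2 v * cos y + k3 * sin y)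
      + tan x * (k3 * cos y - rot k1 k2 v * sin y) * p
      - rot (- k2) k1 v * tan x * cos y * q
      + (rot k1 k2 v * cos y + k3 * sin y) * p\<^sup>2 - rot (- k2) k1 v * sin y * p * q)
   + q * (- (1 + (tan x)\<^sup>2) * rot (- k2) k1 v * sin y - tan x * rot (- k2) k1 v * cos y * p
      - (rot k1 k2 v * tan x * sin y + rot k4 k5 v) * q
      - (rot (- k2) k1 v * sin y * p\<^sup>2 - rot k1 k2 v * cos y * q * p))
   + r * (tan x * (rot k1 k2 v * cos y + k3 * sin y)
      - (2 * (k3 * cos y - rot k1 k2 v * sin y) * p - rot (- k2) k1 v * cos y * q))
   + s * (- rot (- k2) k1 v * tan x * sin y - rot (- k5) k4 v + rot (- k2) k1 v * cos y * p)"
proof -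
  \<comment> \<open>In \<open>x\<close> and \<open>y\<close> the closed form \<open>phi1_K\<close>
    is available only locally, so the function is replaced on a neighbourhood; in \<open>v\<close>,
    \<open>p\<close>, \<open>q\<close> plain unfolding suffices.\<close>
  note cong = DERIV_cong_ev[OF refl eventually_mono[OF eventually_cos_nonzero] refl, THEN iffD2,
      THEN DERIV_imp_deriv]
  have 1: "deriv (\<lambda>t. phi1 K t y v p q) x = 2 * tan x * (1 + (tan x)\<^sup>2) * (rot k1 k2 v * sin y - k3 * cos y)
      + (1 + (tan x)\<^sup>2) * (rot k1 k2 v * cos y + k3 * sin y) * p
      - rot (- k2) k1 v * (1 + (tan x)\<^sup>2) * sin y * q"
    by (rule cong[OF cx], erule phi1_K[OF _ cy])
      (rule DERIV_cong, (rule trig_DERIV derivative_intros cx cy)+,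
      simp add: algebra_simps power2_eq_square)
  have 2: "deriv (\<lambda>t. phi1 K x t v p q) y = (1 + (tan x)\<^sup>2) * (rot k1 k2 v * cos y + k3 * sin y)
      + tan x * (k3 * cos y - rot k1 k2 v * sin y) * p
      - rot (- k2) k1 v * tan x * cos y * q
      + (rot k1 k2 v * cos y + k3 * sin y) * p\<^sup>2 - rot (- k2) k1 v * sin y * p * q"
    by (rule cong[OF cy], erule phi1_K[OF cx])
      (rule DERIV_cong, (rule trig_DERIV derivative_intros cx cy)+,
      simp add: algebra_simps power2_eq_square)
  have 3: "deriv (\<lambda>t. phi1 K x y t p q) v = - (1 + (tan x)\<^sup>2) * rot (- k2) k1 v * sin y - tan x * rot (- k2) k1 v * cos y * p
      - (rot k1 k2 v * tan x * sin y + rot k4 k5 v) * q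
      - (rot (- k2) k1 v * sin y * p\<^sup>2 - rot k1 k2 v * cos y * q * p)"
    unfolding phi1_K[OF cx cy]
    by (rule DERIV_imp_deriv, rule DERIV_cong, (rule trig_DERIV derivative_intros cx cy)+,
      simp add: algebra_simps power2_eq_square rot_def)
  have 4: "deriv (\<lambda>t. phi1 K x y v t q) p = tan x * (rot k1 k2 v * cos y + k3 * sin y)
      - (2 * (k3 * cos y - rot k1 k2 v * sin y) * p - rot (- k2) k1 v * cos y * q)"
    unfolding phi1_K[OF cx cy]
    by (rule DERIV_imp_deriv, rule DERIV_cong, (rule trig_DERIV derivative_intros cx cy)+,
      simp add: algebra_simps power2_eq_square)
  have 5: "deriv (\<lambda>t. phi1 K x y v p t) q =
      - rot (- k2) k1 v * tan x * sin y - rot (- k5) k4 v + rot (- k2) k1 v * cos y * p"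
    unfolding phi1_K[OF cx cy]
    by (rule DERIV_imp_deriv, rule DERIV_cong, (rule trig_DERIV derivative_intros cx cy)+,
      simp add: algebra_simps power2_eq_square)
  show ?thesis unfolding total_d_def 1 2 3 4 5 by (simp add: algebra_simps)
qed

lemma total_d_eta1_K:
  "total_d (eta1 K) x y v p q r s =
     2 * tan x * (1 + (tan x)\<^sup>2) * rot (- k2) k1 v * sec y
      + (1 + (tan x)\<^sup>2) * rot (- k2) k1 v * sec y * tan y * p
      + (1 + (tan x)\<^sup>2) * rot k1 k2 v * sec y * q
   + p * ((1 + (tan x)\<^sup>2) * rot (- k2) k1 v * sec y * tan y
      + (rot (- k2) k1 v * tan x * (sec y * (tan y)\<^sup>2 + sec y * (1 + (tan y)\<^sup>2))
         + 2 * rot (- k5) k4 v * tan y * (1 + (tan y)\<^sup>2)) * p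
      + (rot k1 k2 v * tan x * sec y * tan y + rot k4 k5 v * (1 + (tan y)\<^sup>2)) * q
      + (rot k1 k2 v * cos y + k3 * sin y) * p * q - rot (- k2) k1 v * sin y * q\<^sup>2)
   + q * ((1 + (tan x)\<^sup>2) * rot k1 k2 v * sec y
      + (rot k1 k2 v * tan x * sec y * tan y + rot k4 k5 v * (1 + (tan y)\<^sup>2)) * p
      - (rot (- k2) k1 v * tan x * sec y + rot (- k5) k4 v * tan y) * q
      - rot (- k2) k1 v * sin y * p * q + rot k1 k2 v * cos y * q\<^sup>2)
   + r * (rot (- k2) k1 v * tan x * sec y * tan y + rot (- k5) k4 v * (1 + (tan y)\<^sup>2)
      - (k3 * cos y - rot k1 k2 v * sin y) * q)
   + s * (rot k1 k2 v * tan x * sec y + rot k4 k5 v * tan y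
      - (k3 * cos y - rot k1 k2 v * sin y) * p + 2 * rot (- k2) k1 v * cos y * q)"
proof -
  note cong = DERIV_cong_ev[OF refl eventually_mono[OF eventually_cos_nonzero] refl, THEN iffD2,
      THEN DERIV_imp_deriv]
  have 1: "deriv (\<lambda>t. eta1 K t y v p q) x = 2 * tan x * (1 + (tan x)\<^sup>2) * rot (- k2) k1 v * sec y
      + (1 + (tan x)\<^sup>2) * rot (- k2) k1 v * sec y * tan y * p
      + (1 + (tan x)\<^sup>2) * rot k1 k2 v * sec y * q"
    by (rule cong[OF cx], erule eta1_K[OF _ cy])
      (rule DERIV_cong, (rule trig_DERIV derivative_intros cx cy)+,
      simp add: algebra_simps power2_eq_square)
  have 2: "deriv (\<lambda>t. eta1 K x t v p q) y = (1 + (tan x)\<^sup>2) * rot (- k2) k1 v * sec y * tan y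
      + (rot (- k2) k1 v * tan x * (sec y * (tan y)\<^sup>2 + sec y * (1 + (tan y)\<^sup>2))
         + 2 * rot (- k5) k4 v * tan y * (1 + (tan y)\<^sup>2)) * p
      + (rot k1 k2 v * tan x * sec y * tan y + rot k4 k5 v * (1 + (tan y)\<^sup>2)) * q
      + (rot k1 k2 v * cos y + k3 * sin y) * p * q - rot (- k2) k1 v * sin y * q\<^sup>2"
    by (rule cong[OF cy], erule eta1_K[OF cx])
      (rule DERIV_cong, (rule trig_DERIV derivative_intros cx cy)+,
      simp add: algebra_simps power2_eq_square)
  have 3: "deriv (\<lambda>t. eta1 K x y t p q) v = (1 + (tan x)\<^sup>2) * rot k1 k2 v * sec y
      + (rot k1 k2 v * tan x * sec y * tan y + rot k4 k5 v * (1 + (tan y)\<^sup>2)) * p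
      - (rot (- k2) k1 v * tan x * sec y + rot (- k5) k4 v * tan y) * q
      - rot (- k2) k1 v * sin y * p * q + rot k1 k2 v * cos y * q\<^sup>2"
    unfolding eta1_K[OF cx cy]
    by (rule DERIV_imp_deriv, rule DERIV_cong, (rule trig_DERIV derivative_intros cx cy)+,
      simp add: algebra_simps power2_eq_square rot_def)
  have 4: "deriv (\<lambda>t. eta1 K x y v t q) p = rot (- k2) k1 v * tan x * sec y * tan y + rot (- k5) k4 v * (1 + (tan y)\<^sup>2)
      - (k3 * cos y - rot k1 k2 v * sin y) * q"
    unfolding eta1_K[OF cx cy]
    by (rule DERIV_imp_deriv, rule DERIV_cong, (rule trig_DERIV derivative_intros cx cy)+,
      simp add: algebra_simps power2_eq_square)
  have 5: "deriv (\<lambda>t. eta1 K x y v p t) q = rot k1 k2 v * tan x * sec y + rot k4 k5 v * tan y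
      - (k3 * cos y - rot k1 k2 v * sin y) * p + 2 * rot (- k2) k1 v * cos y * q"
    unfolding eta1_K[OF cx cy]
    by (rule DERIV_imp_deriv, rule DERIV_cong, (rule trig_DERIV derivative_intros cx cy)+,
      simp add: algebra_simps power2_eq_square)
  show ?thesis unfolding total_d_def 1 2 3 4 5 by (simp add: algebra_simps)
qed

end

text \<open>Tangency of the prolonged field to the hypersurface \<open>r = geo_y x y p q\<close>, at
  points where both equations hold. No derivative in \<open>v\<close> appears on the right because
  \<open>geo_y\<close> does not involve \<open>v\<close>.\<close>

lemma phi2_K:
  assumes cx: "cos x \<noteq> 0" and cy: "cos y \<noteq> 0"
    and r: "r = geo_y x y p q" and s: "s = geo_v x y p q"
  shows "phi2 K x y v p q r s =
     xi K x y v * deriv (\<lambda>t. geo_y t y p q) x + phi K x y v * deriv (\<lambda>t. geo_y x t p q) y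
     + phi1 K x y v p q * deriv (\<lambda>t. geo_y x y t q) p
     + eta1 K x y v p q * deriv (\<lambda>t. geo_y x y p t) q" (is "?l = ?r")
proof -
  define c s' T U c1 c2 d1 d2 where defs: "c = cos x" "s' = cos y" "T = tan x" "U = tan y"
    "c1 = rot k1 k2 v" "c2 = rot (- k2) k1 v" "d1 = rot k4 k5 v" "d2 = rot (- k5) k4 v"
  have T: "sin x = T * c" and U: "sin y = U * s'"
    using cx cy by (auto simp: defs tan_def)
  have c: "c^2 * (1 + T^2) - 1 = 0"
    using sin_cos_squared_add[of x] unfolding T defs(1)[symmetric] by algebra
  have s': "s'^2 * (1 + U^2) - 1 = 0"
    using sin_cos_squared_add[of y] unfolding U defs(2)[symmetric] by algebra
  \<comment> \<open>Expressing the secant through cosine and tangent makes the whole identity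
    polynomial.\<close>
  have S: "sec y = s' * (1 + U^2)"
    using s' cy by (simp add: sec_def defs(2)[symmetric] field_simps power2_eq_square)
  \<comment> \<open>The cofactors are found by polynomial division by the two Pythagorean relations.\<close>
  have "?l - ?r = (c^2 * (1 + T^2) - 1) * (- s' * c1 * p^3 - s' * U * k3 * p^3 + 2 * s' *
       U * c2 * p^2 * q + 3 * s' * T * k3 * p^2 - 3 * s' * T * U * c1 * p^2 - s'^3 * c1 *
       p * q^2 - s'^3 * U * k3 * p * q^2 - 2 * s'^3 * U * c2 * p^2 * q - 2 * s'^3 * U^3 *
       c2 * p^2 * q + s'^3 * T * k3 * q^2 - 2 * s'^3 * T * c2 * p * q - s'^3 * T * U * c1
       * q^2 - 2 * s'^3 * T * U^2 * c2 * p * q)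
     + (s'^2 * (1 + U^2) - 1) * (d1 * q^2 + 2 * U * d2 * p * q - s' * c1 * p * q^2 + 2 *
       s' * U * c2 * q - 2 * s' * U * c2 * p^2 * q - 2 * s' * T * c2 * p * q + s' * T * U
       * c1 * q^2 + 2 * s' * T * U^2 * c2 * p * q + 2 * s' * T^2 * U * c2 * q - 2 * c^2 *
       T * d2 * p^2 * q + 2 * c^2 * s' * U * c2 * p^2 * q)"
    unfolding phi2_def total_d_phi1_K[OF cx cy] total_xi_K[OF cx cy]
      DERIV_geo_y[OF cx cy, THEN DERIV_imp_deriv]
    unfolding phi1_K[OF cx cy] eta1_K[OF cx cy] killing_field_components r s geo_y_def geo_v_def
      T U S defs[symmetric]
    by algebra
  then show ?thesis unfolding c s' by simp
qed

text \<open>Tangency to the other hypersurface, \<open>s = geo_v x y p q\<close>, by the same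
  reduction.\<close>

lemma eta2_K:
  assumes cx: "cos x \<noteq> 0" and cy: "cos y \<noteq> 0"
    and r: "r = geo_y x y p q" and s: "s = geo_v x y p q"
  shows "eta2 K x y v p q r s =
     xi K x y v * deriv (\<lambda>t. geo_v t y p q) x + phi K x y v * deriv (\<lambda>t. geo_v x t p q) y
     + phi1 K x y v p q * deriv (\<lambda>t. geo_v x y t q) p
     + eta1 K x y v p q * deriv (\<lambda>t. geo_v x y p t) q" (is "?l = ?r")
proof -
  define c s' T U c1 c2 d1 d2 where defs: "c = cos x" "s' = cos y" "T = tan x" "U = tan y"
    "c1 = rot k1 k2 v" "c2 = rot (- k2) k1 v" "d1 = rot k4 k5 v" "d2 = rot (- k5) k4 v"
  have T: "sin x = T * c" and U: "sin y = U * s'"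
    using cx cy by (auto simp: defs tan_def)
  have c: "c^2 * (1 + T^2) - 1 = 0"
    using sin_cos_squared_add[of x] unfolding T defs(1)[symmetric] by algebra
  have s': "s'^2 * (1 + U^2) - 1 = 0"
    using sin_cos_squared_add[of y] unfolding U defs(2)[symmetric] by algebra
  have S: "sec y = s' * (1 + U^2)"
    using s' cy by (simp add: sec_def defs(2)[symmetric] field_simps power2_eq_square)
  \<comment> \<open>The difference is exhibited as an element of the ideal generated by the
    Pythagorean relations \<open>c\<close> and \<open>s'\<close>.\<close>
  have "?l - ?r = (c^2 * (1 + T^2) - 1) * (- s' * c1 * p^2 * q - s' * U * k3 * p^2 * q + 2
       * s' * U * c2 * p * q^2 + 2 * s' * T * k3 * p * q - s' * T * c2 * p^2 - 2 * s' * T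
       * U * c1 * p * q - s' * T * U^2 * c2 * p^2 - s'^3 * c1 * q^3 - s'^3 * U * k3 * q^3
       - 2 * s'^3 * U * c2 * p * q^2 - 2 * s'^3 * U^3 * c2 * p * q^2 - 3 * s'^3 * T * c2 *
       q^2 - 3 * s'^3 * T * U^2 * c2 * q^2)
     + (s'^2 * (1 + U^2) - 1) * (- U * d2 * q^2 - s' * c1 * q^3 - 2 * s' * U * c2 * p *
       q^2 - 3 * s' * T * c2 * q^2 - s' * T * U^2 * c2 * q^2 - 2 * c^2 * T * d2 * p * q^2
       + 2 * c^2 * s' * U * c2 * p * q^2)"
    unfolding eta2_def total_d_eta1_K[OF cx cy] total_xi_K[OF cx cy]
      DERIV_geo_v[OF cx cy, THEN DERIV_imp_deriv]
    unfolding phi1_K[OF cx cy] eta1_K[OF cx cy] killing_field_components r s geo_y_def geo_v_def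
      T U S defs[symmetric]
    by algebra
  then show ?thesis unfolding c s' by simp
qed

end

section \<open>Invariance of the geodesic system\<close>

text \<open>At a common zero of \<open>g1\<close> and \<open>g2\<close> the product rule keeps only
  the terms that differentiate these factors. The derivatives of \<open>f1\<close> and
  \<open>f2\<close>, later the Hessian entries, have to exist but are never computed.\<close>

lemma deriv_two_vanishing_factors:
  fixes f1 f2 g1 g2 F :: "real \<Rightarrow> real"
  assumes "\<forall>\<^sub>F t in nhds z. F t = f1 t * g1 t + f2 t * g2 t"
    and "f1 differentiable at z" "f2 differentiable at z"
    and g: "(g1 has_real_derivative d1) (at z)" "(g2 has_real_derivative d2) (at z)"
    and "g1 z = 0" "g2 z = 0"
  shows "deriv F z = f1 z * d1 + f2 z * d2"
proof -
  obtain e1 e2 where e: "(f1 has_real_derivative e1) (at z)" "(f2 has_real_derivative e2) (at z)"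
    using assms(2,3) by (auto simp: real_differentiable_def)
  have "((\<lambda>t. f1 t * g1 t + f2 t * g2 t) has_real_derivative f1 z * d1 + f2 z * d2) (at z)"
    using DERIV_add[OF DERIV_mult[OF e(1) g(1)] DERIV_mult[OF e(2) g(2)]] assms(6,7)
    by (simp add: mult.commute)
  then show ?thesis
    using DERIV_cong_ev[OF refl assms(1) refl] DERIV_imp_deriv by blast
qed

context killing
begin

text \<open>On the solution set the derivation \<open>pr2 K\<close> sends \<open>F\<close> to
  \<open>fy\<close> times the image of \<open>r - geo_y\<close> plus \<open>fv\<close> times the
  image of \<open>s - geo_v\<close>; both images vanish by \<open>phi2_K\<close> and
  \<open>eta2_K\<close>.\<close>

lemma pr2_K_vanishes:
  assumes F: "\<And>x y v p q r s. cos x \<noteq> 0 \<Longrightarrow> cos y \<noteq> 0 \<Longrightarrow>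
      F x y v p q r s = fy x y v p q * (r - geo_y x y p q) + fv x y v p q * (s - geo_v x y p q)"
    and f1: "(\<lambda>t. fy t y v p q) differentiable at x" "(\<lambda>t. fy x t v p q) differentiable at y"
      "(\<lambda>t. fy x y t p q) differentiable at v" "(\<lambda>t. fy x y v t q) differentiable at p"
      "(\<lambda>t. fy x y v p t) differentiable at q"
    and f2: "(\<lambda>t. fv t y v p q) differentiable at x" "(\<lambda>t. fv x t v p q) differentiable at y"
      "(\<lambda>t. fv x y t p q) differentiable at v" "(\<lambda>t. fv x y v t q) differentiable at p"
      "(\<lambda>t. fv x y v p t) differentiable at q"
    and cx: "cos x \<noteq> 0" and cy: "cos y \<noteq> 0"
    and r: "r = geo_y x y p q" and s: "s = geo_v x y p q"
  shows "pr2 K F x y v p q r s = 0"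
proof -
  note R = DERIV_geo_y[OF cx cy] and S = DERIV_geo_v[OF cx cy]
  note dR = R[THEN DERIV_imp_deriv] and dS = S[THEN DERIV_imp_deriv]
  note van = deriv_two_vanishing_factors[OF _ _ _
      DERIV_diff[OF DERIV_const] DERIV_diff[OF DERIV_const]]
  have 1: "deriv (\<lambda>t. F t y v p q r s) x = fy x y v p q * - deriv (\<lambda>t. geo_y t y p q) x
      + fv x y v p q * - deriv (\<lambda>t. geo_v t y p q) x"
    unfolding dR dS
    by (subst van[OF eventually_mono[OF eventually_cos_nonzero[OF cx] F[OF _ cy]] f1(1) f2(1) R(1) S(1)])
      (auto simp: r s)
  have 2: "deriv (\<lambda>t. F x t v p q r s) y = fy x y v p q * - deriv (\<lambda>t. geo_y x t p q) y
      + fv x y v p q * - deriv (\<lambda>t. geo_v x t p q) y"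
    unfolding dR dS
    by (subst van[OF eventually_mono[OF eventually_cos_nonzero[OF cy] F[OF cx]] f1(2) f2(2) R(2) S(2)])
      (auto simp: r s)
  \<comment> \<open>Both vanishing factors are constant in \<open>v\<close>.\<close>
  have 3: "deriv (\<lambda>t. F x y t p q r s) v = 0"
    by (subst deriv_two_vanishing_factors[OF always_eventually[OF allI[OF F[OF cx cy]]] f1(3) f2(3) DERIV_const DERIV_const])
      (auto simp: r s)
  have 4: "deriv (\<lambda>t. F x y v t q r s) p = fy x y v p q * - deriv (\<lambda>t. geo_y x y t q) p
      + fv x y v p q * - deriv (\<lambda>t. geo_v x y t q) p"
    unfolding dR dS
    by (subst van[OF always_eventually[OF allI[OF F[OF cx cy]]] f1(4) f2(4) R(3) S(3)])
      (auto simp: r s)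
  have 5: "deriv (\<lambda>t. F x y v p t r s) q = fy x y v p q * - deriv (\<lambda>t. geo_y x y p t) q
      + fv x y v p q * - deriv (\<lambda>t. geo_v x y p t) q"
    unfolding dR dS
    by (subst van[OF always_eventually[OF allI[OF F[OF cx cy]]] f1(5) f2(5) R(4) S(4)])
      (auto simp: r s)
  have 6: "deriv (\<lambda>t. F x y v p q t s) r = fy x y v p q"
    unfolding F[OF cx cy] by (rule DERIV_imp_deriv) (auto intro!: derivative_eq_intros)
  have 7: "deriv (\<lambda>t. F x y v p q r t) s = fv x y v p q"
    unfolding F[OF cx cy] by (rule DERIV_imp_deriv) (auto intro!: derivative_eq_intros)
  show ?thesis
    unfolding pr2_def 1 2 3 4 5 6 7 phi2_K[OF cx cy r s] eta2_K[OF cx cy r s]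
    by (simp add: algebra_simps)
qed

end

lemma chart_cos: "(x, y, v) \<in> chart \<Longrightarrow> cos x > 0 \<and> cos y > 0"
  unfolding chart_def by (auto intro!: cos_gt_zero_pi)

text \<open>Once positive factors are removed, the equations form a homogeneous linear system in
  \<open>P\<close> and \<open>Q\<close> whose determinant
  \<open>1 + a * p\<^sup>2 + a * b * q\<^sup>2\<close> is the square of \<open>Lam\<close>, hence
  positive.\<close>

lemma EL_solved:
  assumes "cos x \<noteq> 0" "cos y \<noteq> 0" "EL_y x y v p q r s = 0" "EL_v x y v p q r s = 0"
  shows "r = geo_y x y p q" "s = geo_v x y p q"
proof -
  define L a b P Q where defs: "L = Lam x y v p q" "a = (cos x)\<^sup>2" "b = (cos y)\<^sup>2"
    "P = r - geo_y x y p q" "Q = s - geo_v x y p q"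
  have pos: "L ^ 3 > 0" "a > 0" "b > 0" using Lam_pos assms by (auto simp: defs)
  have "a * ((1 + a * b * q\<^sup>2) * P - a * b * p * q * Q) = 0"
    using assms(3) pos unfolding EL_y_factor[OF assms(1,2)] defs[symmetric]
    by (simp add: field_simps)
  then have 1: "(1 + a * b * q\<^sup>2) * P = a * b * p * q * Q" using pos by simp
  have "a * b * ((1 + a * p\<^sup>2) * Q - a * p * q * P) = 0"
    using assms(4) pos unfolding EL_v_factor[OF assms(1,2)] defs[symmetric]
    by (simp add: field_simps)
  then have 2: "(1 + a * p\<^sup>2) * Q = a * p * q * P" using pos by simp
  have W: "1 + a * p\<^sup>2 + a * b * q\<^sup>2 \<noteq> 0"
    using pos by (smt (verit) mult_nonneg_nonneg zero_le_power2)
  have "(1 + a * p\<^sup>2 + a * b * q\<^sup>2) * P = 0" "(1 + a * p\<^sup>2 + a * b * q\<^sup>2) * Q = 0"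
    using 1 2 by algebra+
  then have "P = 0" "Q = 0" using W by auto
  then show "r = geo_y x y p q" "s = geo_v x y p q" by (auto simp: defs)
qed

lemma DERIV_differentiable: "(f has_real_derivative d) (at z) \<Longrightarrow> f differentiable at z"
  by (auto simp: real_differentiable_def)

context killing
begin

lemma geodesic_system_symmetry_K: "geodesic_system_symmetry K"
  unfolding geodesic_system_symmetry_def
proof (intro allI impI)
  fix x y v p q r s :: real
  assume c: "(x, y, v) \<in> chart" and E: "EL_y x y v p q r s = 0" "EL_v x y v p q r s = 0"
  have cx: "cos x \<noteq> 0" and cy: "cos y \<noteq> 0" using chart_cos[OF c] by auto
  note L = power_not_zero[OF Lam_nonzero]
  have "pr2 K EL_y x y v p q r s = 0"
    \<comment> \<open>\<open>fy\<close> and \<open>fv\<close> are the coefficients of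
      \<open>EL_y_factor\<close>. What remains is their differentiability in each of the five
      variables, which holds because \<open>Lam\<close> has no zeros.\<close>
    by (rule pr2_K_vanishes[where
          fy = "\<lambda>x y v p q. - ((cos x)\<^sup>2 * (1 + (cos x)\<^sup>2 * (cos y)\<^sup>2 * q\<^sup>2)) / Lam x y v p q ^ 3" and
          fv = "\<lambda>x y v p q. (cos x)\<^sup>2 * (cos x)\<^sup>2 * (cos y)\<^sup>2 * p * q / Lam x y v p q ^ 3",
        OF EL_y_factor _ _ _ _ _ _ _ _ _ _ cx cy EL_solved[OF cx cy E]], assumption, assumption)
      (rule DERIV_differentiable, (rule derivative_intros L DERIV_Lam)+)+
  moreover have "pr2 K EL_v x y v p q r s = 0"
    by (rule pr2_K_vanishes[where
          fy = "\<lambda>x y v p q. (cos x)\<^sup>2 * (cos x)\<^sup>2 * (cos y)\<^sup>2 * p * q / Lam x y v p q ^ 3" and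
          fv = "\<lambda>x y v p q. - ((cos x)\<^sup>2 * (cos y)\<^sup>2 * (1 + (cos x)\<^sup>2 * p\<^sup>2)) / Lam x y v p q ^ 3",
        OF EL_v_factor _ _ _ _ _ _ _ _ _ _ cx cy EL_solved[OF cx cy E]], assumption, assumption)
      (rule DERIV_differentiable, (rule derivative_intros L DERIV_Lam)+)+
  ultimately show "pr2 K EL_y x y v p q r s = 0 \<and> pr2 K EL_v x y v p q r s = 0" ..
qed

end

section \<open>Integration of Killing's equations\<close>

lemma zero_deriv_imp_eq:
  fixes f :: "real \<Rightarrow> real"
  assumes "convex S" "\<And>t. t \<in> S \<Longrightarrow> (f has_real_derivative 0) (at t)" "s \<in> S" "t \<in> S"
  shows "f s = f t"
  using has_field_derivative_zero_constant[of S f] assms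
  by (metis has_field_derivative_at_within)

text \<open>Rotating the pair \<open>(f, g)\<close> by the angle \<open>t\<close> gives quantities
  \<open>p\<close> and \<open>q\<close> of derivative zero; their constant values are
  \<open>A\<close> and \<open>B\<close>.\<close>

lemma harmonic_oscillator:
  fixes f g :: "real \<Rightarrow> real"
  assumes "convex S"
    and f: "\<And>t. t \<in> S \<Longrightarrow> (f has_real_derivative g t) (at t)"
    and g: "\<And>t. t \<in> S \<Longrightarrow> (g has_real_derivative - f t) (at t)"
  obtains A B where "\<And>t. t \<in> S \<Longrightarrow> f t = A * cos t + B * sin t"
    "\<And>t. t \<in> S \<Longrightarrow> g t = B * cos t - A * sin t"
proof (cases "S = {}")
  case False
  then obtain s where s: "s \<in> S" by blast
  define p q where "p t = f t * cos t - g t * sin t" and "q t = f t * sin t + g t * cos t" for t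
  have p: "(p has_real_derivative 0) (at t)" and q: "(q has_real_derivative 0) (at t)" if "t \<in> S" for t
    unfolding p_def[abs_def] q_def[abs_def]
    by (auto intro!: derivative_eq_intros f[OF that] g[OF that])
  have pq: "p t = p s" "q t = q s" if "t \<in> S" for t
    using zero_deriv_imp_eq[OF \<open>convex S\<close> p that s] zero_deriv_imp_eq[OF \<open>convex S\<close> q that s] by simp_all
  have "f t = p t * cos t + q t * sin t" "g t = q t * cos t - p t * sin t" for t
    using sin_cos_squared_add[of t] unfolding p_def q_def by algebra+
  then show ?thesis using that[of "p s" "q s"] pq by simp
qed (use that in auto)

text \<open>Six of the nine derivatives are prescribed by Killing's equations;
  \<open>\<xi>y\<close>, \<open>\<xi>v\<close> and \<open>\<phi>v\<close> merely name the other
  three. Their differentiability is not assumed and has to be extracted from the equations.\<close>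

lemma killing_equations_solution:
  fixes \<xi> \<phi> \<eta> \<xi>y \<xi>v \<phi>v :: "real \<Rightarrow> real \<Rightarrow> real \<Rightarrow> real"
  defines "I \<equiv> {- pi / 2 <..< pi / 2}" and "J \<equiv> {0 <..< 2 * pi}"
  assumes xi: "\<And>x y v. x \<in> I \<Longrightarrow> y \<in> I \<Longrightarrow> v \<in> J \<Longrightarrow> ((\<lambda>t. \<xi> t y v) has_real_derivative 0) (at x)"
      "\<And>x y v. x \<in> I \<Longrightarrow> y \<in> I \<Longrightarrow> v \<in> J \<Longrightarrow> ((\<lambda>t. \<xi> x t v) has_real_derivative \<xi>y x y v) (at y)"
      "\<And>x y v. x \<in> I \<Longrightarrow> y \<in> I \<Longrightarrow> v \<in> J \<Longrightarrow> ((\<lambda>t. \<xi> x y t) has_real_derivative \<xi>v x y v) (at v)"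
    and phi: "\<And>x y v. x \<in> I \<Longrightarrow> y \<in> I \<Longrightarrow> v \<in> J \<Longrightarrow>
        ((\<lambda>t. \<phi> t y v) has_real_derivative - \<xi>y x y v / (cos x)\<^sup>2) (at x)"
      "\<And>x y v. x \<in> I \<Longrightarrow> y \<in> I \<Longrightarrow> v \<in> J \<Longrightarrow>
        ((\<lambda>t. \<phi> x t v) has_real_derivative tan x * \<xi> x y v) (at y)"
      "\<And>x y v. x \<in> I \<Longrightarrow> y \<in> I \<Longrightarrow> v \<in> J \<Longrightarrow> ((\<lambda>t. \<phi> x y t) has_real_derivative \<phi>v x y v) (at v)"
    and eta: "\<And>x y v. x \<in> I \<Longrightarrow> y \<in> I \<Longrightarrow> v \<in> J \<Longrightarrow>
        ((\<lambda>t. \<eta> t y v) has_real_derivative - \<xi>v x y v / ((cos x)\<^sup>2 * (cos y)\<^sup>2)) (at x)"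
      "\<And>x y v. x \<in> I \<Longrightarrow> y \<in> I \<Longrightarrow> v \<in> J \<Longrightarrow>
        ((\<lambda>t. \<eta> x t v) has_real_derivative - \<phi>v x y v / (cos y)\<^sup>2) (at y)"
      "\<And>x y v. x \<in> I \<Longrightarrow> y \<in> I \<Longrightarrow> v \<in> J \<Longrightarrow>
        ((\<lambda>t. \<eta> x y t) has_real_derivative tan x * \<xi> x y v + tan y * \<phi> x y v) (at v)"
  obtains k1 k2 k3 k4 k5 k6 where
    "\<And>x y v. x \<in> I \<Longrightarrow> y \<in> I \<Longrightarrow> v \<in> J \<Longrightarrow> \<xi> x y v = (k1 * cos v + k2 * sin v) * cos y + k3 * sin y"
    "\<And>x y v. x \<in> I \<Longrightarrow> y \<in> I \<Longrightarrow> v \<in> J \<Longrightarrow> \<phi> x y v = (k1 * cos v + k2 * sin v) * tan x * sin y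
        - k3 * tan x * cos y + k4 * cos v + k5 * sin v"
    "\<And>x y v. x \<in> I \<Longrightarrow> y \<in> I \<Longrightarrow> v \<in> J \<Longrightarrow> \<eta> x y v = (k1 * sin v - k2 * cos v) * tan x / cos y
        + (k4 * sin v - k5 * cos v) * tan y + k6"
proof -
  have conv: "convex I" "convex J" and op: "open I" "open J" by (auto simp: I_def J_def)
  have zI: "0 \<in> I" and qI: "pi / 4 \<in> I" and pJ: "pi \<in> J" by (auto simp: I_def J_def)
  have c0: "cos t \<noteq> 0" if "t \<in> I" for t
    using cos_gt_zero_pi[of t] that by (auto simp: I_def)
  have q1: "tan (pi / 4) = 1" by (rule tan_45)
  note tr = has_field_derivative_transform_within_open

  have xi0: "\<xi> x y v = \<xi> 0 y v" if "x \<in> I" "y \<in> I" "v \<in> J" for x y v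
    by (rule zero_deriv_imp_eq[OF conv(1) xi(1)[OF _ that(2,3)] that(1) zI])
  \<comment> \<open>As \<open>\<xi>\<close> does not depend on x, its y-derivative at
    \<open>x\<close> is also a derivative of the slice x = 0, and derivatives are unique.\<close>
  have xiy0: "\<xi>y x y v = \<xi>y 0 y v" if "x \<in> I" "y \<in> I" "v \<in> J" for x y v
  proof -
    have "((\<lambda>t. \<xi> 0 t v) has_real_derivative \<xi>y x y v) (at y)"
      by (rule tr[OF xi(2)[OF that] op(1) that(2)]) (rule xi0[OF that(1) _ that(3)])
    from DERIV_unique[OF this xi(2)[OF zI that(2,3)]] show ?thesis .
  qed
  have xiv0: "\<xi>v x y v = \<xi>v 0 y v" if "x \<in> I" "y \<in> I" "v \<in> J" for x y v
  proof -
    have "((\<lambda>t. \<xi> 0 y t) has_real_derivative \<xi>v x y v) (at v)"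
      by (rule tr[OF xi(3)[OF that] op(2) that(3)]) (rule xi0[OF that(1,2)])
    from DERIV_unique[OF this xi(3)[OF zI that(2,3)]] show ?thesis .
  qed

  \<comment> \<open>Integration in x: the slope \<open>\<xi>y\<close> is constant in x, and the
    tangent is an antiderivative of 1 / cos^2.\<close>
  have phi0: "\<phi> x y v = \<phi> 0 y v - \<xi>y 0 y v * tan x" if "x \<in> I" "y \<in> I" "v \<in> J" for x y v
  proof -
    have "((\<lambda>x. \<phi> x y v + \<xi>y 0 y v * tan x) has_real_derivative 0) (at t)" if "t \<in> I" for t
      by (rule DERIV_cong[OF DERIV_add[OF phi(1)[OF that \<open>y \<in> I\<close> \<open>v \<in> J\<close>]
            DERIV_cmult[OF DERIV_tan[OF c0[OF that]]]]])
        (simp add: xiy0[OF that \<open>y \<in> I\<close> \<open>v \<in> J\<close>] divide_inverse)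
    from zero_deriv_imp_eq[OF conv(1) this \<open>x \<in> I\<close> zI] show ?thesis by simp
  qed
  have eta0: "\<eta> x y v = \<eta> 0 y v - \<xi>v 0 y v / (cos y)\<^sup>2 * tan x" if "x \<in> I" "y \<in> I" "v \<in> J" for x y v
  proof -
    have "((\<lambda>x. \<eta> x y v + \<xi>v 0 y v / (cos y)\<^sup>2 * tan x) has_real_derivative 0) (at t)" if "t \<in> I" for t
      by (rule DERIV_cong[OF DERIV_add[OF eta(1)[OF that \<open>y \<in> I\<close> \<open>v \<in> J\<close>]
            DERIV_cmult[OF DERIV_tan[OF c0[OF that]]]]])
        (simp add: xiv0[OF that \<open>y \<in> I\<close> \<open>v \<in> J\<close>] divide_inverse)
    from zero_deriv_imp_eq[OF conv(1) this \<open>x \<in> I\<close> zI] show ?thesis by simp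
  qed
  \<comment> \<open>Since \<open>tan\<close> grows from 0 to 1 between the two slices,
    \<open>P\<close> recovers \<open>\<xi>y\<close> and \<open>Q\<close> recovers
    \<open>\<xi>v\<close> up to the factor \<open>(cos y)\<^sup>2\<close>. Being differences of
    values of \<open>\<phi>\<close> and \<open>\<eta>\<close>, they can be differentiated.\<close>
  define P Q where "P y v = \<phi> 0 y v - \<phi> (pi / 4) y v" and "Q y v = \<eta> 0 y v - \<eta> (pi / 4) y v" for y v
  have P: "\<xi>y 0 y v = P y v" if "y \<in> I" "v \<in> J" for y v
    using phi0[OF qI that] q1 by (simp add: P_def)
  have Q: "\<xi>v 0 y v = Q y v * (cos y)\<^sup>2" if "y \<in> I" "v \<in> J" for y v
    using eta0[OF qI that] q1 c0[OF that(1)] by (simp add: Q_def)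

  \<comment> \<open>The slice x = 0 contributes nothing and the other one leaves
    \<open>- \<xi> 0 y v\<close>: in y, \<open>\<xi>\<close> and \<open>P\<close> form an
    oscillator.\<close>
  have Py: "((\<lambda>t. P t v) has_real_derivative - \<xi> 0 y v) (at y)" if "y \<in> I" "v \<in> J" for y v
    unfolding P_def using DERIV_diff[OF phi(2)[OF zI that] phi(2)[OF qI that]] xi0[OF qI that] q1
    by simp
  define \<alpha> \<beta> where "\<alpha> v = \<xi> 0 0 v" and "\<beta> v = P 0 v" for v
  have ab: "\<xi> 0 y v = \<alpha> v * cos y + \<beta> v * sin y \<and> P y v = \<beta> v * cos y - \<alpha> v * sin y"
    if "y \<in> I" "v \<in> J" for y v
  proof -
    obtain A B where 1: "\<And>t. t \<in> I \<Longrightarrow> \<xi> 0 t v = A * cos t + B * sin t"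
      "\<And>t. t \<in> I \<Longrightarrow> P t v = B * cos t - A * sin t"
      by (rule harmonic_oscillator[OF conv(1) DERIV_cong[OF xi(2)[OF zI _ \<open>v \<in> J\<close>] P[OF _ \<open>v \<in> J\<close>]]
            Py[OF _ \<open>v \<in> J\<close>]]) auto
    show ?thesis using 1(1)[OF zI] 1(2)[OF zI] 1[OF \<open>y \<in> I\<close>] by (simp add: \<alpha>_def \<beta>_def)
  qed

  \<comment> \<open>On the line x = y = 0, \<open>\<alpha>\<close> and \<open>Q 0\<close> form an
    oscillator in v, which yields \<open>k1\<close> and \<open>k2\<close>.\<close>
  have \<alpha>': "(\<alpha> has_real_derivative Q 0 v) (at v)" if "v \<in> J" for v
    unfolding \<alpha>_def[abs_def] using xi(3)[OF zI zI that] Q[OF zI that] by simp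
  have Q': "((\<lambda>v. Q 0 v) has_real_derivative - \<alpha> v) (at v)" if "v \<in> J" for v
    unfolding Q_def \<alpha>_def
    using DERIV_diff[OF eta(3)[OF zI zI that] eta(3)[OF qI zI that]] xi0[OF qI zI that] q1
    by simp
  obtain k1 k2 where k12: "\<And>v. v \<in> J \<Longrightarrow> \<alpha> v = k1 * cos v + k2 * sin v"
    "\<And>v. v \<in> J \<Longrightarrow> Q 0 v = k2 * cos v - k1 * sin v"
    by (rule harmonic_oscillator[OF conv(2) \<alpha>' Q']) auto

  define \<beta>' where "\<beta>' v = \<phi>v 0 0 v - \<phi>v (pi / 4) 0 v" for v
  have \<beta>: "(\<beta> has_real_derivative \<beta>' v) (at v)" if "v \<in> J" for v
    unfolding \<beta>_def[abs_def] \<beta>'_def P_def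
    by (rule DERIV_diff[OF phi(3)[OF zI zI that] phi(3)[OF qI zI that]])
  \<comment> \<open>Differentiating the formula \<open>ab\<close> in v gives a second expression for
    \<open>\<xi>v\<close>.\<close>
  have Qy: "Q y v * (cos y)\<^sup>2 = Q 0 v * cos y + \<beta>' v * sin y" if "y \<in> I" "v \<in> J" for y v
  proof -
    have "((\<lambda>v. \<alpha> v * cos y + \<beta> v * sin y) has_real_derivative Q 0 v * cos y + \<beta>' v * sin y) (at v)"
      by (auto intro!: derivative_eq_intros \<alpha>' \<beta> that)
    then have "((\<lambda>v. \<xi> 0 y v) has_real_derivative Q 0 v * cos y + \<beta>' v * sin y) (at v)"
      by (rule tr[OF _ op(2) \<open>v \<in> J\<close>]) (use ab that in simp)
    from DERIV_unique[OF xi(3)[OF zI that] this] show ?thesis using Q[OF that] by simp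
  qed
  \<comment> \<open>The y-derivative of \<open>Q\<close> at 0 is computed twice: \<open>Qy\<close>
    gives \<open>\<beta>' v\<close>, the equation between \<open>\<eta>\<close> and
    \<open>\<phi>v\<close> gives its negative. Hence \<open>\<beta>\<close> is constant.\<close>
  have \<beta>'0: "\<beta>' v = 0" if "v \<in> J" for v
  proof -
    have "((\<lambda>y. (Q 0 v * cos y + \<beta>' v * sin y) / (cos y)\<^sup>2) has_real_derivative \<beta>' v) (at 0)"
      by (auto intro!: derivative_eq_intros)
    then have "((\<lambda>y. Q y v) has_real_derivative \<beta>' v) (at 0)"
      by (rule tr[OF _ op(1) zI]) (simp add: Qy[OF _ that, symmetric] c0)
    moreover have "((\<lambda>y. Q y v) has_real_derivative - \<beta>' v) (at 0)"
      unfolding Q_def \<beta>'_def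
      using DERIV_diff[OF eta(2)[OF zI zI that] eta(2)[OF qI zI that]] by simp
    ultimately have "\<beta>' v = - \<beta>' v" by (rule DERIV_unique)
    then show ?thesis by simp
  qed
  \<comment> \<open>The base point is \<open>pi\<close> because the open interval \<open>J\<close>
    does not contain 0.\<close>
  define k3 where "k3 = \<beta> pi"
  have k3: "\<beta> v = k3" if "v \<in> J" for v
    unfolding k3_def by (rule zero_deriv_imp_eq[OF conv(2) _ that pJ]) (metis \<beta> \<beta>'0)

  define b where "b v = \<phi> 0 0 v" for v
  \<comment> \<open>On the slice x = 0 the prescribed y-derivative of \<open>\<phi>\<close> carries
    the factor \<open>tan 0 = 0\<close>.\<close>
  have b: "\<phi> 0 y v = b v" if "y \<in> I" "v \<in> J" for y v
    unfolding b_def by (rule zero_deriv_imp_eq[OF conv(1) _ that(1) zI])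
      (rule DERIV_cong[OF phi(2)[OF zI _ that(2)]], assumption, simp)
  have b': "\<phi>v 0 y v = \<phi>v 0 0 v" if "y \<in> I" "v \<in> J" for y v
  proof -
    have "(b has_real_derivative \<phi>v 0 y v) (at v)"
      by (rule tr[OF phi(3)[OF zI that] op(2) that(2)]) (rule b[OF that(1)])
    from DERIV_unique[OF this phi(3)[OF zI zI that(2), folded b_def]] show ?thesis .
  qed
  have eta00: "\<eta> 0 y v = \<eta> 0 0 v - \<phi>v 0 0 v * tan y" if "y \<in> I" "v \<in> J" for y v
  proof -
    have "((\<lambda>y. \<eta> 0 y v + \<phi>v 0 0 v * tan y) has_real_derivative 0) (at t)" if "t \<in> I" for t
      by (rule DERIV_cong[OF DERIV_add[OF eta(2)[OF zI that \<open>v \<in> J\<close>]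
            DERIV_cmult[OF DERIV_tan[OF c0[OF that]]]]])
        (simp add: b'[OF that \<open>v \<in> J\<close>] divide_inverse)
    from zero_deriv_imp_eq[OF conv(1) this \<open>y \<in> I\<close> zI] show ?thesis by simp
  qed
  define k6 where "k6 = \<eta> 0 0 pi"
  have k6: "\<eta> 0 0 v = k6" if "v \<in> J" for v
    unfolding k6_def by (rule zero_deriv_imp_eq[OF conv(2) _ that pJ])
      (rule DERIV_cong[OF eta(3)[OF zI zI]], assumption, simp)
  \<comment> \<open>The comparison of slices is repeated in y: at \<open>y = pi / 4\<close>,
    \<open>eta00\<close> expresses \<open>\<phi>v 0 0 v\<close> through \<open>\<eta>\<close>, which
    can be differentiated. So \<open>b\<close> is an oscillator in v, giving \<open>k4\<close> and
    \<open>k5\<close>.\<close>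
  have 1: "(b has_real_derivative k6 - \<eta> 0 (pi / 4) v) (at v)" if "v \<in> J" for v
    unfolding b_def[abs_def] using phi(3)[OF zI zI that] eta00[OF qI that] k6[OF that] q1 by simp
  have 2: "((\<lambda>v. k6 - \<eta> 0 (pi / 4) v) has_real_derivative - b v) (at v)" if "v \<in> J" for v
    using DERIV_diff[OF DERIV_const eta(3)[OF zI qI that], of k6] b[OF qI that] q1 by simp
  obtain k4 k5 where k45: "\<And>v. v \<in> J \<Longrightarrow> b v = k4 * cos v + k5 * sin v"
    "\<And>v. v \<in> J \<Longrightarrow> k6 - \<eta> 0 (pi / 4) v = k5 * cos v - k4 * sin v"
    by (rule harmonic_oscillator[OF conv(2) 1 2]) auto

  show ?thesis
  proof (rule that[of k1 k2 k3 k4 k5 k6])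
    fix x y v assume h: "x \<in> I" "y \<in> I" "v \<in> J"
    show "\<xi> x y v = (k1 * cos v + k2 * sin v) * cos y + k3 * sin y"
      using xi0[OF h] ab[OF h(2,3)] k12[OF h(3)] k3[OF h(3)] by simp
    show "\<phi> x y v = (k1 * cos v + k2 * sin v) * tan x * sin y
        - k3 * tan x * cos y + k4 * cos v + k5 * sin v"
      using phi0[OF h] P[OF h(2,3)] ab[OF h(2,3)] b[OF h(2,3)] k12[OF h(3)] k3[OF h(3)] k45[OF h(3)]
      by (simp add: algebra_simps)
    have "(Q y v * cos y - (k2 * cos v - k1 * sin v)) * cos y = 0"
      using Qy[OF h(2,3)] \<beta>'0[OF h(3)] k12(2)[OF h(3)]
      by (simp add: algebra_simps power2_eq_square)
    then have "Q y v * cos y - (k2 * cos v - k1 * sin v) = 0"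
      using c0[OF h(2)] by (simp only: mult_eq_0_iff simp_thms)
    then have "Q y v = (k2 * cos v - k1 * sin v) / cos y"
      using c0[OF h(2)] by (simp add: field_simps)
    then have "\<eta> x y v = \<eta> 0 y v - (k2 * cos v - k1 * sin v) / cos y * tan x"
      using eta0[OF h] Q[OF h(2,3)] c0[OF h(2)] by simp
    moreover have "\<eta> 0 y v = k6 - (k5 * cos v - k4 * sin v) * tan y"
      using eta00[OF h(2,3)] eta00[OF qI h(3)] k45(2)[OF h(3)] k6[OF h(3)] q1 by simp
    ultimately show "\<eta> x y v = (k1 * sin v - k2 * cos v) * tan x / cos y
        + (k4 * sin v - k5 * cos v) * tan y + k6"
      using c0[OF h(2)] by (simp add: field_simps)
  qed
qed

section \<open>Arclength in hyperspherical coordinates\<close>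

lemma vector_4:
  "(vector [a, b, c, d] :: 'a::zero ^ 4) $ 1 = a" "(vector [a, b, c, d] :: 'a ^ 4) $ 2 = b"
  "(vector [a, b, c, d] :: 'a ^ 4) $ 3 = c" "(vector [a, b, c, d] :: 'a ^ 4) $ 4 = d"
  unfolding vector_def by simp_all

lemma has_vector_derivative_vector_4:
  fixes a b c d :: "real \<Rightarrow> real"
  assumes "(a has_real_derivative a') F" "(b has_real_derivative b') F"
    "(c has_real_derivative c') F" "(d has_real_derivative d') F"
  shows "((\<lambda>t. vector [a t, b t, c t, d t] :: real ^ 4) has_vector_derivative vector [a', b', c', d']) F"
proof -
  have e: "(vector [a, b, c, d] :: real ^ 4) = a *\<^sub>R axis 1 1 + b *\<^sub>R axis 2 1 + c *\<^sub>R axis 3 1 + d *\<^sub>R axis 4 1"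
    for a b c d
    by (simp add: vec_eq_iff forall_4 vector_4 axis_def)
  have s: "((\<lambda>t. f t *\<^sub>R (u :: real ^ 4)) has_vector_derivative f' *\<^sub>R u) F"
    if "(f has_real_derivative f') F" for f f' u
    using bounded_linear.has_vector_derivative[OF bounded_linear_scaleR_left[of u]
        that[unfolded has_real_derivative_iff_has_vector_derivative]] .
  show ?thesis unfolding e by (intro has_vector_derivative_add s assms)
qed

lemma norm_vector_4: "norm (vector [a, b, c, d] :: real ^ 4) = sqrt (a\<^sup>2 + b\<^sup>2 + c\<^sup>2 + d\<^sup>2)"
  by (simp add: norm_vec_def L2_set_def sum_4 vector_4)

text \<open>The Euclidean metric pulls back to the diagonal metric of the sphere, the mixed terms
  cancelling by Pythagoras. The filter has to be nontrivial so that the derivative within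
  \<open>I\<close> is unique.\<close>

lemma speed_eq_Lam:
  assumes "at x within I \<noteq> bot"
    and "(y has_real_derivative p) (at x within I)" "(v has_real_derivative q) (at x within I)"
  shows "norm (vector_derivative (\<lambda>t. hyperspherical t (y t) (v t)) (at x within I))
    = Lam x (y x) (v x) p q"
proof -
  let ?d = "vector [
      - sin x * cos (y x) * cos (v x) - cos x * sin (y x) * p * cos (v x) - cos x * cos (y x) * sin (v x) * q,
      - sin x * cos (y x) * sin (v x) - cos x * sin (y x) * p * sin (v x) + cos x * cos (y x) * cos (v x) * q,
      - sin x * sin (y x) + cos x * cos (y x) * p, cos x] :: real ^ 4"
  have "((\<lambda>t. hyperspherical t (y t) (v t)) has_vector_derivative ?d) (at x within I)"
    unfolding hyperspherical_def
    by (intro has_vector_derivative_vector_4)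
      (rule DERIV_cong, (rule derivative_intros assms(2,3))+, simp add: algebra_simps)+
  then have "vector_derivative (\<lambda>t. hyperspherical t (y t) (v t)) (at x within I) = ?d"
    by (rule vector_derivative_within[OF assms(1)])
  moreover have "norm ?d = Lam x (y x) (v x) p q"
    unfolding norm_vector_4 Lam_def
    using sin_cos_squared_add[of x] sin_cos_squared_add[of "y x"] sin_cos_squared_add[of "v x"]
    by (intro arg_cong[where f = sqrt]) algebra
  ultimately show ?thesis by simp
qed

lemma arclength_eq_Lam_integral:
  assumes "is_interval I" "y differentiable_on I" "v differentiable_on I"
  shows "arclength I y v = integral I (\<lambda>x. Lam x (y x) (v x)
    (vector_derivative y (at x within I)) (vector_derivative v (at x within I)))"
proof (cases "\<exists>a. I \<subseteq> {a}")
  \<comment> \<open>On a degenerate interval the derivatives within \<open>I\<close> are not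
    determined, but both integrals are zero.\<close>
  case True
  then obtain a where "I = {} \<or> I = {a}" by blast
  then show ?thesis by (auto simp: arclength_def)
next
  case False
  have deriv: "(f has_real_derivative vector_derivative f (at x within I)) (at x within I)"
    if "f differentiable_on I" "x \<in> I" for f x
    using that by (simp add: differentiable_on_def vector_derivative_works
        has_real_derivative_iff_has_vector_derivative)
  show ?thesis unfolding arclength_def
  proof (rule integral_cong)
    fix x assume "x \<in> I"
    \<comment> \<open>A connected set with more than one point has no isolated points.\<close>
    then have "x islimpt I"
      using connected_imp_perfect[of I x] is_interval_connected[OF assms(1)] False by blast
    then have "at x within I \<noteq> bot" by (simp add: trivial_limit_within)
    then show "norm (vector_derivative (\<lambda>t. hyperspherical t (y t) (v t)) (at x within I))
        = Lam x (y x) (v x) (vector_derivative y (at x within I)) (vector_derivative v (at x within I))"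
      by (rule speed_eq_Lam) (rule deriv assms(2,3) \<open>x \<in> I\<close>)+
  qed
qed

section \<open>The variational criterion and Killing's equations\<close>

text \<open>The cubic part of \<open>Lam\<close> squared times \<open>total_xi\<close> cancels
  against the quadratic terms of \<open>phi1\<close> and \<open>eta1\<close> multiplied by the
  momenta. The numerator left is half the Lie derivative of the metric along \<open>V\<close>,
  evaluated on the velocity (1, p, q).\<close>

lemma pr1_Lam:
  assumes "cos x \<noteq> 0" "cos y \<noteq> 0"
  shows "pr1 V Lam x y v p q + Lam x y v p q * total_xi V x y v p q =
    (d_x (xi V) x y v + (d_y (xi V) x y v + (cos x)\<^sup>2 * d_x (phi V) x y v) * p
      + (d_v (xi V) x y v + (cos x)\<^sup>2 * (cos y)\<^sup>2 * d_x (eta V) x y v) * q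
      + (cos x)\<^sup>2 * (d_y (phi V) x y v - tan x * xi V x y v) * p\<^sup>2
      + (cos x)\<^sup>2 * (d_v (phi V) x y v + (cos y)\<^sup>2 * d_y (eta V) x y v) * (p * q)
      + (cos x)\<^sup>2 * (cos y)\<^sup>2 * (d_v (eta V) x y v - tan x * xi V x y v - tan y * phi V x y v) * q\<^sup>2)
    / Lam x y v p q"
proof -
  define L where "L = Lam x y v p q"
  have L: "z * L = z * L\<^sup>2 / L" "L * z = z * L\<^sup>2 / L" for z
    using Lam_nonzero[of x y v p q] by (auto simp: L_def power2_eq_square)
  have L2: "L\<^sup>2 = 1 + (cos x)\<^sup>2 * p\<^sup>2 + (cos x)\<^sup>2 * (cos y)\<^sup>2 * q\<^sup>2" by (simp add: L_def Lam_sq)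
  have T: "sin x = tan x * cos x" and U: "sin y = tan y * cos y"
    using assms by (auto simp: tan_def)
  show ?thesis
    unfolding pr1_def deriv_Lam L_def[symmetric] L(2) times_divide_eq_right mult_zero_right
      add_divide_distrib[symmetric] add_0_right
    by (rule arg_cong[where f = "\<lambda>z. z / L"], unfold L2 T U phi1_def eta1_def total_xi_def, algebra)
qed

lemma quadratic_form_zero_iff:
  fixes a b c d e f :: real
  shows "(\<forall>p q. a + b * p + c * q + d * p\<^sup>2 + e * (p * q) + f * q\<^sup>2 = 0) \<longleftrightarrow>
    a = 0 \<and> b = 0 \<and> c = 0 \<and> d = 0 \<and> e = 0 \<and> f = 0" (is "?l \<longleftrightarrow> ?r")
proof
  assume h: ?l
  show ?r
    \<comment> \<open>The origin isolates \<open>a\<close>, the opposite pairs on the axes separate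
      \<open>b\<close> from \<open>d\<close> and \<open>c\<close> from \<open>f\<close>, and (1, 1)
      then gives \<open>e\<close>.\<close>
    using h[rule_format, of 0 0] h[rule_format, of 1 0] h[rule_format, of "-1" 0] h[rule_format, of 0 1]
      h[rule_format, of 0 "-1"] h[rule_format, of 1 1] by simp
qed simp

lemma killing_equations_iff:
  assumes "cos x \<noteq> 0" "cos y \<noteq> 0"
  shows "(\<forall>p q. pr1 V Lam x y v p q + Lam x y v p q * total_xi V x y v p q = 0) \<longleftrightarrow>
    d_x (xi V) x y v = 0 \<and>
    d_y (xi V) x y v + (cos x)\<^sup>2 * d_x (phi V) x y v = 0 \<and>
    d_v (xi V) x y v + (cos x)\<^sup>2 * (cos y)\<^sup>2 * d_x (eta V) x y v = 0 \<and>
    d_y (phi V) x y v = tan x * xi V x y v \<and>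
    d_v (phi V) x y v + (cos y)\<^sup>2 * d_y (eta V) x y v = 0 \<and>
    d_v (eta V) x y v = tan x * xi V x y v + tan y * phi V x y v"
  unfolding pr1_Lam[OF assms] using assms Lam_nonzero
  by (auto simp: quadratic_form_zero_iff)

lemma open_chart: "open chart"
  unfolding chart_def by (intro open_Times open_greaterThanLessThan)

lemma chart_iff:
  "(x, y, v) \<in> chart \<longleftrightarrow> x \<in> {- pi / 2 <..< pi / 2} \<and> y \<in> {- pi / 2 <..< pi / 2} \<and> v \<in> {0 <..< 2 * pi}"
  by (auto simp: chart_def)

text \<open>\<open>V\<close> is totally differentiable at each point of the open chart, hence along
  coordinate lines, so the values of \<open>deriv\<close> are genuine partial derivatives.\<close>

lemma DERIV_components:
  assumes "V differentiable_on chart" "(x, y, v) \<in> chart" and F: "F \<in> {xi V, phi V, eta V}"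
  shows "((\<lambda>t. F t y v) has_real_derivative d_x F x y v) (at x)"
    "((\<lambda>t. F x t v) has_real_derivative d_y F x y v) (at y)"
    "((\<lambda>t. F x y t) has_real_derivative d_v F x y v) (at v)"
proof -
  have V: "V differentiable (at (x, y, v))"
    using assms open_chart differentiable_on_eq_differentiable_at by blast
  have comp: "(\<lambda>t. f (V (g t))) differentiable (at s)"
    if "g s = (x, y, v)" "g differentiable (at s)" "bounded_linear f" for f :: "_ \<Rightarrow> real" and g and s :: real
    using differentiable_chain_at[OF differentiable_chain_at[OF that(2), of V]
        bounded_linear_imp_differentiable[OF that(3)]] V that(1)
    by (simp add: o_def)
  have lin: "bounded_linear (\<lambda>P. fst P :: real)" "bounded_linear (\<lambda>P :: real \<times> real \<times> real. fst (snd P))"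
    "bounded_linear (\<lambda>P :: real \<times> real \<times> real. snd (snd P))"
    by (intro bounded_linear_intros)+
  show "((\<lambda>t. F t y v) has_real_derivative d_x F x y v) (at x)"
    "((\<lambda>t. F x t v) has_real_derivative d_y F x y v) (at y)"
    "((\<lambda>t. F x y t) has_real_derivative d_v F x y v) (at v)"
    using F unfolding d_x_def d_y_def d_v_def DERIV_deriv_iff_real_differentiable
    by (auto simp: xi_def[abs_def] phi_def[abs_def] eta_def[abs_def] intro!: comp lin)
qed

text \<open>The criterion sees only values and first derivatives at points of the chart, and on an
  open set equal values give equal derivatives.\<close>

lemma variational_symmetry_cong:
  assumes "\<And>P. P \<in> chart \<Longrightarrow> V P = W P" "variational_symmetry W"
  shows "variational_symmetry V"
proof -
  have W: "W differentiable_on chart" using assms(2) by (simp add: variational_symmetry_def)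
  have V: "V differentiable_on chart"
    using W assms(1) by (simp add: differentiable_on_def) (metis differentiable_transform_within zero_less_one)
  have F: "xi V x y v = xi W x y v \<and> phi V x y v = phi W x y v \<and> eta V x y v = eta W x y v"
    if "(x, y, v) \<in> chart" for x y v
    using assms(1)[OF that] by (simp add: xi_def phi_def eta_def)
  have d: "d_x G x y v = d_x F x y v \<and> d_y G x y v = d_y F x y v \<and> d_v G x y v = d_v F x y v"
    if c: "(x, y, v) \<in> chart" and eq: "\<And>x y v. (x, y, v) \<in> chart \<Longrightarrow> G x y v = F x y v" for F G x y v
  proof -
    have "\<forall>\<^sub>F t in nhds x. (t, y, v) \<in> chart" "\<forall>\<^sub>F t in nhds y. (x, t, v) \<in> chart"
      "\<forall>\<^sub>F t in nhds v. (x, y, t) \<in> chart"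
      using eventually_nhds_in_open[OF open_greaterThanLessThan, of x "- pi / 2" "pi / 2"]
        eventually_nhds_in_open[OF open_greaterThanLessThan, of y "- pi / 2" "pi / 2"]
        eventually_nhds_in_open[OF open_greaterThanLessThan, of v 0 "2 * pi"] c
      unfolding chart_iff by auto
    then show ?thesis unfolding d_x_def d_y_def d_v_def
      by (intro conjI deriv_cong_ev) (auto elim!: eventually_mono intro: eq)
  qed
  have "d_x (xi V) x y v = d_x (xi W) x y v \<and> d_y (xi V) x y v = d_y (xi W) x y v \<and> d_v (xi V) x y v = d_v (xi W) x y v"
    "d_x (phi V) x y v = d_x (phi W) x y v \<and> d_y (phi V) x y v = d_y (phi W) x y v \<and> d_v (phi V) x y v = d_v (phi W) x y v"
    "d_x (eta V) x y v = d_x (eta W) x y v \<and> d_y (eta V) x y v = d_y (eta W) x y v \<and> d_v (eta V) x y v = d_v (eta W) x y v"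
    if "(x, y, v) \<in> chart" for x y v
    using F by (intro d[OF that]; simp)+
  then show ?thesis
    using V F assms(2) unfolding variational_symmetry_def pr1_def phi1_def eta1_def total_xi_def by simp
qed

lemma (in killing) killing_field_differentiable: "K differentiable_on chart"
proof -
  have K: "K = (\<lambda>P. (xi K (fst P) (fst (snd P)) (snd (snd P)), phi K (fst P) (fst (snd P)) (snd (snd P)),
      eta K (fst P) (fst (snd P)) (snd (snd P))))"
    by (auto simp: fun_eq_iff xi_def phi_def eta_def)
  have "K differentiable at P" if "P \<in> chart" for P
  proof -
    have c: "cos (fst P) \<noteq> 0" "cos (fst (snd P)) \<noteq> 0"
      using chart_cos[of "fst P" "fst (snd P)" "snd (snd P)"] that by auto
    show ?thesis
      unfolding differentiable_def
      by (subst K, unfold killing_field_components rot_def sec_def, rule exI)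
        (rule derivative_intros c)+
  qed
  then show ?thesis by (simp add: differentiable_at_imp_differentiable_on)
qed

lemma (in killing) variational_symmetry_K: "variational_symmetry K"
  unfolding variational_symmetry_def
proof (intro conjI allI impI killing_field_differentiable)
  fix x y v p q :: real
  assume "(x, y, v) \<in> chart"
  then have cx: "cos x \<noteq> 0" and cy: "cos y \<noteq> 0" using chart_cos by fastforce+
  have x: "(cos x)\<^sup>2 * (1 + (tan x)\<^sup>2) = 1" and y: "(cos y)\<^sup>2 * (1 + (tan y)\<^sup>2) = 1"
    using tan_sec[OF cx] tan_sec[OF cy] cx cy by (simp_all add: power_inverse)
  have T: "sin x = tan x * cos x" and U: "sin y = tan y * cos y" and S: "sec y * cos y = 1"
    using cx cy by (auto simp: tan_def sec_def)
  show "pr1 K Lam x y v p q + Lam x y v p q * total_xi K x y v p q = 0"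
    by (rule killing_equations_iff[OF cx cy, THEN iffD2, rule_format],
        unfold d_x_def d_y_def d_v_def killing_field_d[OF cx cy], unfold killing_field_components T U)
      (intro conjI; (rule refl | use x y S in algebra))
qed

lemma variational_symmetry_imp_killing_field:
  assumes "variational_symmetry V"
  obtains k1 k2 k3 k4 k5 k6 where "\<And>P. P \<in> chart \<Longrightarrow> V P = killing_field k1 k2 k3 k4 k5 k6 P"
proof -
  have V: "V differentiable_on chart" using assms by (simp add: variational_symmetry_def)
  note D = DERIV_components[OF V]
  have cos: "(cos x)\<^sup>2 > 0 \<and> (cos y)\<^sup>2 > 0" if "(x, y, v) \<in> chart" for x y v
    using chart_cos[OF that] by simp
  have E: "d_x (xi V) x y v = 0"
    "d_x (phi V) x y v = - d_y (xi V) x y v / (cos x)\<^sup>2"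
    "d_x (eta V) x y v = - d_v (xi V) x y v / ((cos x)\<^sup>2 * (cos y)\<^sup>2)"
    "d_y (phi V) x y v = tan x * xi V x y v"
    "d_y (eta V) x y v = - d_v (phi V) x y v / (cos y)\<^sup>2"
    "d_v (eta V) x y v = tan x * xi V x y v + tan y * phi V x y v" if c: "(x, y, v) \<in> chart" for x y v
  proof -
    \<comment> \<open>Isolates the derivative multiplied by cosines, the form in which
      \<open>killing_equations_solution\<close> takes the mixed equations.\<close>
    have solve: "b = - a / c" if "a + c * b = 0" "c \<noteq> 0" for a b c :: real
    proof -
      have "b * c = - a" using that(1) by algebra
      then show ?thesis by (simp only: nonzero_eq_divide_eq[OF that(2)])
    qed
    have k: "cos x \<noteq> 0" "cos y \<noteq> 0" using chart_cos[OF c] by auto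
    have "\<forall>p q. pr1 V Lam x y v p q + Lam x y v p q * total_xi V x y v p q = 0"
      using assms c by (simp add: variational_symmetry_def)
    note e = this[unfolded killing_equations_iff[OF k]]
    show "d_x (xi V) x y v = 0" "d_y (phi V) x y v = tan x * xi V x y v"
      "d_v (eta V) x y v = tan x * xi V x y v + tan y * phi V x y v"
      using e by auto
    show "d_x (phi V) x y v = - d_y (xi V) x y v / (cos x)\<^sup>2"
      "d_x (eta V) x y v = - d_v (xi V) x y v / ((cos x)\<^sup>2 * (cos y)\<^sup>2)"
      "d_y (eta V) x y v = - d_v (phi V) x y v / (cos y)\<^sup>2"
      by (rule solve; use e k in simp)+
  qed
  have c: "(x, y, v) \<in> chart"
    if "x \<in> {- pi / 2 <..< pi / 2}" "y \<in> {- pi / 2 <..< pi / 2}" "v \<in> {0 <..< 2 * pi}" for x y v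
    using that by (simp add: chart_def)
  obtain k1 k2 k3 k4 k5 k6 where k:
    "\<And>x y v. (x, y, v) \<in> chart \<Longrightarrow> xi V x y v = (k1 * cos v + k2 * sin v) * cos y + k3 * sin y"
    "\<And>x y v. (x, y, v) \<in> chart \<Longrightarrow> phi V x y v = (k1 * cos v + k2 * sin v) * tan x * sin y
        - k3 * tan x * cos y + k4 * cos v + k5 * sin v"
    "\<And>x y v. (x, y, v) \<in> chart \<Longrightarrow> eta V x y v = (k1 * sin v - k2 * cos v) * tan x / cos y
        + (k4 * sin v - k5 * cos v) * tan y + k6"
    by (rule killing_equations_solution[of "xi V" "d_y (xi V)" "d_v (xi V)" "phi V" "d_v (phi V)" "eta V"])
      (auto simp only: chart_iff intro: DERIV_cong[OF D(1)[OF c] E(1)[OF c]] D(2,3)[OF c]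
        DERIV_cong[OF D(1)[OF c] E(2)[OF c]] DERIV_cong[OF D(1)[OF c] E(3)[OF c]]
        DERIV_cong[OF D(2)[OF c] E(4)[OF c]] DERIV_cong[OF D(2)[OF c] E(5)[OF c]]
        DERIV_cong[OF D(3)[OF c] E(6)[OF c]] insertI1 insertI2)
  have "V P = killing_field k1 k2 k3 k4 k5 k6 P" if "P \<in> chart" for P
  proof -
    obtain x y v where P: "P = (x, y, v)" by (cases P)
    have "V (x, y, v) = (xi V x y v, phi V x y v, eta V x y v)" by (simp add: xi_def phi_def eta_def)
    then show ?thesis
      using k that unfolding P by (simp add: killing_field_def glome_field_def chi6_def sec_def)
  qed
  then show ?thesis by (rule that)
qed

section \<open>The sixth symmetry and the assembled theorem\<close>

lemma glome_field_eq_killing_field: "glome_field k1 k2 k3 k4 k5 = killing_field k1 k2 k3 k4 k5 0"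
  by (simp add: fun_eq_iff killing_field_def flip: zero_prod_def)

lemma chi6_eq_killing_field: "chi6 = killing_field 0 0 0 0 0 1"
  by (auto simp: fun_eq_iff killing_field_def glome_field_def zero_prod_def)

text \<open>\<open>chi4\<close> rotates the plane of the first and third ambient coordinates,
  \<open>chi5\<close> that of the second and third; their bracket rotates the first two, which is
  translation in \<open>v\<close>. The opposite order would give \<open>- chi6\<close>.\<close>

lemma lie_bracket_chi5_chi4:
  assumes "P \<in> chart"
  shows "lie_bracket chi5 chi4 P = chi6 P"
proof -
  obtain x y v where P: "P = (x, y, v)" by (cases P)
  have c: "cos y \<noteq> 0" using chart_cos assms unfolding P by fastforce
  have tan: "deriv (\<lambda>t. a * tan t) y = a * (1 + (tan y)\<^sup>2)" for a
    by (rule DERIV_imp_deriv) (rule DERIV_cmult[OF DERIV_tan_sq[OF c]])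
  have trig: "deriv cos v = - sin v" "deriv sin v = cos v"
    "deriv (\<lambda>t. sin t * tan y) v = cos v * tan y" "deriv (\<lambda>t. - (cos t * tan y)) v = sin v * tan y"
    by (rule DERIV_imp_deriv, auto intro!: derivative_eq_intros)+
  have minus_tan: "deriv (\<lambda>t. - (cos v * tan t)) y = - (cos v * (1 + (tan y)\<^sup>2))"
    using tan[of "- cos v"] by simp
  show ?thesis
    unfolding P
    by (simp add: lie_bracket_def apply_vf_def xi_def phi_def eta_def d_x_def d_y_def d_v_def
        chi4_def chi5_def chi6_def tan trig minus_tan)
      (use sin_cos_squared_add[of v] in algebra)
qed

text \<open>At \<open>(0, 0, pi)\<close> both tangents vanish, so the last component of every
  \<open>glome_field\<close> is zero there.\<close>

lemma chi6_not_glome_field: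
  "\<not> (\<exists>k1 k2 k3 k4 k5. \<forall>P \<in> chart. chi6 P = glome_field k1 k2 k3 k4 k5 P)"
proof -
  have "(0, 0, pi) \<in> chart" by (simp add: chart_def)
  moreover have "chi6 (0, 0, pi) \<noteq> glome_field k1 k2 k3 k4 k5 (0, 0, pi)" for k1 k2 k3 k4 k5
    by (simp add: chi6_def glome_field_def)
  ultimately show ?thesis by blast
qed

lemma glome_field_eq_sum:
  "glome_field k1 k2 k3 k4 k5 P =
    k1 *\<^sub>R chi1 P + k2 *\<^sub>R chi2 P + k3 *\<^sub>R chi3 P + k4 *\<^sub>R chi4 P + k5 *\<^sub>R chi5 P"
  by (cases P) (simp add: glome_field_def chi1_def chi2_def chi3_def chi4_def chi5_def algebra_simps)

theorem mainTheorem1: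
  shows
    "(\<forall>I y v. is_interval I \<and> I \<subseteq> {- pi / 2 .. pi / 2} \<and>
        y differentiable_on I \<and> v differentiable_on I \<longrightarrow>
        arclength I y v =
          integral I (\<lambda>x. Lam x (y x) (v x)
            (vector_derivative y (at x within I)) (vector_derivative v (at x within I)))) \<and>
     (\<forall>k1 k2 k3 k4 k5.
        variational_symmetry (glome_field k1 k2 k3 k4 k5) \<and>
        geodesic_system_symmetry (glome_field k1 k2 k3 k4 k5)) \<and>
     (\<forall>k1 k2 k3 k4 k5. \<forall>P \<in> chart.
        glome_field k1 k2 k3 k4 k5 P =
          k1 *\<^sub>R chi1 P + k2 *\<^sub>R chi2 P + k3 *\<^sub>R chi3 P + k4 *\<^sub>R chi4 P + k5 *\<^sub>R chi5 P) \<and>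
     (\<exists>X \<in> {chi1, chi2, chi3, chi4, chi5}. \<exists>Y \<in> {chi1, chi2, chi3, chi4, chi5}.
        \<forall>P \<in> chart. lie_bracket X Y P = chi6 P) \<and>
     variational_symmetry chi6 \<and> geodesic_system_symmetry chi6 \<and>
     \<not> (\<exists>k1 k2 k3 k4 k5. \<forall>P \<in> chart. chi6 P = glome_field k1 k2 k3 k4 k5 P) \<and>
     (\<forall>V. variational_symmetry V \<longleftrightarrow>
        (\<exists>k1 k2 k3 k4 k5 k6. \<forall>P \<in> chart.
           V P = glome_field k1 k2 k3 k4 k5 P + k6 *\<^sub>R chi6 P))"
proof (intro conjI allI impI ballI)
  fix I :: "real set" and y v :: "real \<Rightarrow> real"
  assume "is_interval I \<and> I \<subseteq> {- pi / 2 .. pi / 2} \<and> y differentiable_on I \<and> v differentiable_on I"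
  then show "arclength I y v = integral I (\<lambda>x. Lam x (y x) (v x)
      (vector_derivative y (at x within I)) (vector_derivative v (at x within I)))"
    by (intro arclength_eq_Lam_integral) auto
next
  fix k1 k2 k3 k4 k5
  show "variational_symmetry (glome_field k1 k2 k3 k4 k5)"
    "geodesic_system_symmetry (glome_field k1 k2 k3 k4 k5)"
    unfolding glome_field_eq_killing_field
    by (rule killing.variational_symmetry_K killing.geodesic_system_symmetry_K)+
next
  show "\<exists>X \<in> {chi1, chi2, chi3, chi4, chi5}. \<exists>Y \<in> {chi1, chi2, chi3, chi4, chi5}.
      \<forall>P \<in> chart. lie_bracket X Y P = chi6 P"
    by (rule bexI[of _ chi5], rule bexI[of _ chi4]) (simp_all add: lie_bracket_chi5_chi4)
next
  show "variational_symmetry chi6" "geodesic_system_symmetry chi6"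
    unfolding chi6_eq_killing_field
    by (rule killing.variational_symmetry_K killing.geodesic_system_symmetry_K)+
next
  fix V
  show "variational_symmetry V \<longleftrightarrow> (\<exists>k1 k2 k3 k4 k5 k6. \<forall>P \<in> chart.
      V P = glome_field k1 k2 k3 k4 k5 P + k6 *\<^sub>R chi6 P)"
  proof
    assume "variational_symmetry V"
    then show "\<exists>k1 k2 k3 k4 k5 k6. \<forall>P \<in> chart. V P = glome_field k1 k2 k3 k4 k5 P + k6 *\<^sub>R chi6 P"
      by (rule variational_symmetry_imp_killing_field) (unfold killing_field_def, blast)
  next
    assume "\<exists>k1 k2 k3 k4 k5 k6. \<forall>P \<in> chart. V P = glome_field k1 k2 k3 k4 k5 P + k6 *\<^sub>R chi6 P"
    then obtain k1 k2 k3 k4 k5 k6 where "\<And>P. P \<in> chart \<Longrightarrow> V P = killing_field k1 k2 k3 k4 k5 k6 P"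
      unfolding killing_field_def by blast
    then show "variational_symmetry V"
      by (rule variational_symmetry_cong[OF _ killing.variational_symmetry_K])
  qed
qed (rule glome_field_eq_sum chi6_not_glome_field)+

end
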